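(* Let $H$ be a finite graph without multiple edges, possibly with loops, with no isolated vertices, and with maximum degree $\Delta$ (loops counting once toward the degree). Let $n\geq 2$ and $G \in \mathcal{G}(n,1)$. \begin{enumerate} \item Suppose that $H \neq K_{\Delta}^{\text{loop}}$ and $\hom(K_2,H) \geq \Delta^2$. Then \[ \hom(G,H) \leq \hom(K_2,H)^{\frac{n}{2}}, \] with equality only for $G = \frac{n}{2} K_{2}$. \item Suppose that $\hom(K_2,H) < \Delta^2$, and let $n_0 = n_0(H)$ be the smallest integer in $\{3,4,\ldots\}$ satisfying $\hom(K_2,H) < \hom(K_{1,n_0-1},H)^{\frac{2}{n_0}}$. \begin{enumerate} \item If $2 \leq n < n_0$, then \[ \hom(G,H) \leq \hom(K_{2},H)^{\frac{n}{2}}, \] with equality only for $G=\frac{n}{2} K_2$, unless $n=n_0-1$ and $\hom(K_2,H) = \hom(K_{1,n_0-2},H)^{\frac{2}{n_0-1}}$, in which case $G = K_{1,n-1}$ also achieves equality. \item If $n \geq n_0$, then \[ \hom(G,H) \leq \hom(K_{1,n-1},H), \] with equality only for $G = K_{1,n-1}$. \end{enumerate} \end{enumerate}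
   Context: For a finite simple (loopless) graph $G$ and a finite graph $H$ (no multiple edges, loops allowed), $\hom(G,H)$ is the number of maps $f:V(G)\to V(H)$ such that $v\sim_G w$ implies $f(v)\sim_H f(w)$. For $v\in V(H)$, $d(v)$ is the degree of $v$, where a loop counts once; $\Delta=\max_{v\in V(H)} d(v)$. A vertex of $H$ is isolated if it is incident to no edge and no loop. $\mathcal{G}(n,\delta)$ is the set of all $n$-vertex finite simple graphs with minimum degree (exactly) $\delta$. $K_\Delta^{\text{loop}}$ is the fully looped complete graph on $\Delta$ vertices. $K_{a,b}$ is the complete bipartite graph with parts of sizes $a$ and $b$. $\frac{n}{2}K_2$ is the disjoint union of $n/2$ copies of $K_2$ (it exists only when $2\mid n$). Graph equality is up to isomorphism. *)

theory Defs
  imports Complex_Main "Graph_Theory.Graph_Theory"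
begin

text \<open>
  Undirected graphs without multiple edges are symmetric digraphs over pairs: a finite simple graph
  is a \<open>pair_graph\<close>, and a finite graph in which loops are allowed is a \<open>pair_pseudo_graph\<close>.
  A non-loop edge is represented by two arcs and a loop by one, so \<open>out_degree\<close> is the graph degree
  in which a loop counts once.
\<close>

abbreviation graph_iso :: "'a pair_pre_digraph \<Rightarrow> 'b pair_pre_digraph \<Rightarrow> bool"  (infix "\<simeq>\<^sub>G" 50)
  where "G \<simeq>\<^sub>G H \<equiv> digraph_iso (with_proj G) (with_proj H)"

abbreviation degree :: "'a pair_pre_digraph \<Rightarrow> 'a \<Rightarrow> nat"
  where "degree G v \<equiv> out_degree (with_proj G) v"

definition min_degree :: "'a pair_pre_digraph \<Rightarrow> nat"
  where "min_degree G = Min (degree G ` pverts G)"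

definition max_degree :: "'a pair_pre_digraph \<Rightarrow> nat"
  where "max_degree G = Max (degree G ` pverts G)"

definition isolated :: "'a pair_pre_digraph \<Rightarrow> 'a \<Rightarrow> bool"
  where "isolated G v \<longleftrightarrow> v \<in> pverts G \<and> (\<forall>e\<in>parcs G. fst e \<noteq> v \<and> snd e \<noteq> v)"

definition graphs_min_degree :: "nat \<Rightarrow> nat \<Rightarrow> 'a pair_pre_digraph set"
  where "graphs_min_degree n \<delta> = {G. pair_graph G \<and> card (pverts G) = n \<and> min_degree G = \<delta>}"

text \<open>Maps are taken extensional outside the vertex set of \<open>G\<close>, so that each is counted once.\<close>

definition homs :: "'a pair_pre_digraph \<Rightarrow> 'b pair_pre_digraph \<Rightarrow> ('a \<Rightarrow> 'b) set"
  where "homs G H =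
    {f \<in> pverts G \<rightarrow>\<^sub>E pverts H. \<forall>v w. (v, w) \<in> parcs G \<longrightarrow> (f v, f w) \<in> parcs H}"

definition hom :: "'a pair_pre_digraph \<Rightarrow> 'b pair_pre_digraph \<Rightarrow> nat"
  where "hom G H = card (homs G H)"

definition complete_graph :: "nat \<Rightarrow> nat pair_pre_digraph"
  where "complete_graph k =
    \<lparr>pverts = {..<k}, parcs = {(u, v). u < k \<and> v < k \<and> u \<noteq> v}\<rparr>"

definition complete_looped_graph :: "nat \<Rightarrow> nat pair_pre_digraph"
  where "complete_looped_graph k = \<lparr>pverts = {..<k}, parcs = {..<k} \<times> {..<k}\<rparr>"

definition complete_bipartite_graph :: "nat \<Rightarrow> nat \<Rightarrow> (nat + nat) pair_pre_digraph"
  where "complete_bipartite_graph a b =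
    \<lparr>pverts = {..<a} <+> {..<b},
     parcs = (Inl ` {..<a}) \<times> (Inr ` {..<b}) \<union> (Inr ` {..<b}) \<times> (Inl ` {..<a})\<rparr>"

definition disjoint_copies :: "nat \<Rightarrow> 'a pair_pre_digraph \<Rightarrow> (nat \<times> 'a) pair_pre_digraph"
  where "disjoint_copies m G =
    \<lparr>pverts = {..<m} \<times> pverts G,
     parcs = {((i, u), (j, v)). i < m \<and> i = j \<and> (u, v) \<in> parcs G}\<rparr>"

definition star_exceeds :: "'a pair_pre_digraph \<Rightarrow> nat \<Rightarrow> bool"
  where "star_exceeds H m \<longleftrightarrow> 3 \<le> m \<and>
    real (hom (complete_graph 2) H)
      < real (hom (complete_bipartite_graph 1 (m - 1)) H) powr (2 / real m)"

text \<open>Meaningful only if some \<open>m\<close> with \<open>star_exceeds H m\<close> exists.\<close>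

definition n0 :: "'a pair_pre_digraph \<Rightarrow> nat"
  where "n0 H = (LEAST m. star_exceeds H m)"

end

theory Submission
  imports Defs
begin

text \<open>
  A graph without isolated vertices has a spanning subgraph whose components are stars, and the number of
  homomorphisms from \<open>K\<^bsub>1,k\<^esub>\<close> to \<open>H\<close> is the power sum \<open>S(k) = \<Sum>\<^sub>v d(v)\<^sup>k\<close>. Hence \<open>hom(G, H)\<close> is
  at most a product of numbers \<open>S(k\<^sub>i)\<close> with \<open>\<Sum>\<^sub>i (k\<^sub>i + 1) = n\<close>. If \<open>S(1) \<ge> \<Delta>\<^sup>2\<close>, then
  \<open>S(k) \<le> S(1) \<Delta>\<^bsup>k-1\<^esup> \<le> S(1)\<^bsup>(k+1)/2\<^esup>\<close>, with equality for \<open>k \<ge> 2\<close> only if \<open>H\<close> is a complete looped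
  graph. If \<open>S(1) < \<Delta>\<^sup>2\<close>, then \<open>H\<close> is not regular, so that \<open>S\<close> is strictly log-convex by Cauchy-Schwarz;
  thus \<open>ln S(m - 1) - (m/2) ln S(1)\<close> is strictly convex in \<open>m\<close> and vanishes at \<open>m = 2\<close>, its sign changes
  once, at \<open>n\<^sub>0\<close>, and its positive part is superadditive. Edges of \<open>G\<close> outside an extremal spanning
  subgraph are excluded by exhibiting a homomorphism that they destroy.
\<close>

section \<open>Star decompositions\<close>

definition induced :: "'a pair_pre_digraph \<Rightarrow> 'a set \<Rightarrow> 'a pair_pre_digraph"
  where "induced G A = \<lparr>pverts = A, parcs = parcs G \<inter> A \<times> A\<rparr>"

definition star_graph :: "'a \<Rightarrow> 'a set \<Rightarrow> 'a pair_pre_digraph"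
  where "star_graph x A = \<lparr>pverts = A, parcs = {x} \<times> (A - {x}) \<union> (A - {x}) \<times> {x}\<rparr>"

definition no_isolated :: "'a pair_pre_digraph \<Rightarrow> bool"
  where "no_isolated G \<longleftrightarrow> (\<forall>v\<in>pverts G. \<exists>w. (v, w) \<in> parcs G)"

text \<open>For a simple graph this says that the graph itself is a disjoint union of edges, not
  merely that it contains a perfect matching. No isomorphism has to be chosen.\<close>

definition perfect_matching :: "'a pair_pre_digraph \<Rightarrow> bool"
  where "perfect_matching G \<longleftrightarrow> (\<forall>v\<in>pverts G. \<exists>!w. (v, w) \<in> parcs G)"

definition degree_power_sum :: "'a pair_pre_digraph \<Rightarrow> nat \<Rightarrow> nat"
  where "degree_power_sum H k = (\<Sum>v\<in>pverts H. degree H v ^ k)"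

lemma induced_simps [simp]:
  "pverts (induced G A) = A"
  "parcs (induced G A) = parcs G \<inter> A \<times> A"
  by (simp_all add: induced_def)

lemma star_graph_simps [simp]:
  "pverts (star_graph x A) = A"
  "parcs (star_graph x A) = {x} \<times> (A - {x}) \<union> (A - {x}) \<times> {x}"
  by (simp_all add: star_graph_def)

section \<open>Graphs and degrees in terms of arc sets\<close>

lemma pair_pseudo_graph_iff:
  "pair_pseudo_graph G \<longleftrightarrow> finite (pverts G) \<and> parcs G \<subseteq> pverts G \<times> pverts G \<and> sym (parcs G)"
proof
  assume "pair_pseudo_graph G"
  then interpret pair_pseudo_graph G .
  show "finite (pverts G) \<and> parcs G \<subseteq> pverts G \<times> pverts G \<and> sym (parcs G)"
    using pair_finite_verts wellformed' arcs_symmetric by (auto simp: sym_def)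
next
  assume *: "finite (pverts G) \<and> parcs G \<subseteq> pverts G \<times> pverts G \<and> sym (parcs G)"
  then have "finite (parcs G)" by (meson finite_SigmaI finite_subset)
  with * show "pair_pseudo_graph G"
    by unfold_locales (auto simp: symmetric_def)
qed

lemma pair_graph_iff:
  "pair_graph G \<longleftrightarrow> finite (pverts G) \<and> parcs G \<subseteq> pverts G \<times> pverts G
     \<and> sym (parcs G) \<and> (\<forall>v. (v, v) \<notin> parcs G)"
proof
  assume "pair_graph G"
  then interpret pair_graph G .
  have "pair_pseudo_graph G" ..
  then show "finite (pverts G) \<and> parcs G \<subseteq> pverts G \<times> pverts G
     \<and> sym (parcs G) \<and> (\<forall>v. (v, v) \<notin> parcs G)"
    using pair_no_loops unfolding pair_pseudo_graph_iff by fastforce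
next
  assume *: "finite (pverts G) \<and> parcs G \<subseteq> pverts G \<times> pverts G
     \<and> sym (parcs G) \<and> (\<forall>v. (v, v) \<notin> parcs G)"
  then interpret pair_pseudo_graph G by (simp add: pair_pseudo_graph_iff)
  show "pair_graph G" using * by unfold_locales (metis prod.collapse)
qed

lemma pair_graph_induced: "pair_graph G \<Longrightarrow> A \<subseteq> pverts G \<Longrightarrow> pair_graph (induced G A)"
  by (auto simp: pair_graph_iff sym_def intro: finite_subset)

lemma degree_eq_card_neighbours: "degree G v = card {w. (v, w) \<in> parcs G}"
proof -
  have "out_arcs (with_proj G) v = Pair v ` {w. (v, w) \<in> parcs G}"
    by (auto simp: out_arcs_def)
  then show ?thesis
    by (simp add: out_degree_def card_image inj_on_def)
qed

lemma card_ge_2_no_isolated: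
  assumes "pair_graph G" "no_isolated G" "pverts G \<noteq> {}"
  shows "2 \<le> card (pverts G)"
proof -
  obtain v where "v \<in> pverts G" using assms(3) by blast
  then obtain w where "(v, w) \<in> parcs G" using assms(2) by (auto simp: no_isolated_def)
  then have "{v, w} \<subseteq> pverts G" "v \<noteq> w" and "finite (pverts G)"
    using assms(1) by (auto simp: pair_graph_iff)
  then show ?thesis using card_mono[of "pverts G" "{v, w}"] by simp
qed

text \<open>
  Delete an edge \<open>{x, y}\<close>, and let \<open>I\<close> be the set of vertices this isolates. Each vertex of \<open>I\<close> is
  adjacent to \<open>x\<close> or to \<open>y\<close>, so that either all of \<open>I \<union> {x, y}\<close> is covered by one star, or the
  neighbours of \<open>x\<close> in \<open>I\<close> form a star with \<open>x\<close> and what remains of \<open>I\<close> is attached to \<open>y\<close>.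
\<close>

lemma star_decomposition:
  assumes G: "pair_graph G" "no_isolated G" and "pverts G \<noteq> {}"
  obtains A x where "A \<subseteq> pverts G" "x \<in> A" "2 \<le> card A"
    "\<And>w. w \<in> A - {x} \<Longrightarrow> (x, w) \<in> parcs G" "no_isolated (induced G (pverts G - A))"
proof -
  let ?V = "pverts G" and ?E = "parcs G"
  have fin: "finite ?V" and EV: "\<And>a b. (a, b) \<in> ?E \<Longrightarrow> a \<in> ?V \<and> b \<in> ?V"
    and sym: "\<And>a b. (a, b) \<in> ?E \<Longrightarrow> (b, a) \<in> ?E" and irr: "\<And>a b. (a, b) \<in> ?E \<Longrightarrow> a \<noteq> b"
    using G(1) by (auto simp: pair_graph_iff sym_def)
  have nbr: "\<exists>w. (v, w) \<in> ?E" if "v \<in> ?V" for v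
    using G(2) that by (auto simp: no_isolated_def)
  obtain x y where xy: "(x, y) \<in> ?E"
    using assms(3) nbr by (metis ex_in_conv)
  define I where "I = {v \<in> ?V - {x, y}. \<forall>w. (v, w) \<in> ?E \<longrightarrow> w \<in> {x, y}}"
  define X where "X = {v \<in> I. (x, v) \<in> ?E}"
  have I_y: "(y, v) \<in> ?E" if "v \<in> I - X" for v
  proof -
    from that obtain w where w: "(v, w) \<in> ?E" using nbr by (auto simp: I_def)
    with that have "w \<in> {x, y}" by (auto simp: I_def)
    with that w sym show ?thesis by (auto simp: X_def)
  qed
  \<comment> \<open>A neighbour outside \<open>{x, y}\<close> cannot lie in \<open>I\<close>,
    because vertices of \<open>I\<close> see only \<open>x\<close> and \<open>y\<close>.\<close>
  have other: "\<exists>w\<in>?V - {x, y} - I. (v, w) \<in> ?E" if "v \<in> ?V - {x, y} - I" for v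
  proof -
    from that obtain w where "(v, w) \<in> ?E" "w \<notin> {x, y}" by (auto simp: I_def)
    moreover have "w \<notin> I" using that sym[OF \<open>(v, w) \<in> ?E\<close>] by (auto simp: I_def)
    ultimately show ?thesis using EV by blast
  qed
  have IV: "I \<subseteq> ?V - {x, y}" by (auto simp: I_def)
  have rest: "no_isolated (induced G (?V - ({x, y} \<union> I)))"
    unfolding no_isolated_def
  proof
    fix v assume "v \<in> pverts (induced G (?V - ({x, y} \<union> I)))"
    then have v: "v \<in> ?V - {x, y} - I" by simp
    then obtain w where "w \<in> ?V - {x, y} - I" "(v, w) \<in> ?E" using other by blast
    with v have "(v, w) \<in> parcs (induced G (?V - ({x, y} \<union> I)))" by simp
    then show "\<exists>w. (v, w) \<in> parcs (induced G (?V - ({x, y} \<union> I)))" by blast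
  qed
  have card2: "2 \<le> card ({a, b} \<union> J)" if "(a, b) \<in> ?E" "J \<subseteq> ?V" for a b J
    using card_mono[of "{a, b} \<union> J" "{a, b}"] irr[OF that(1)] finite_subset[OF that(2) fin] by simp
  consider "I = X" | "X = {}" | "X \<noteq> {}" "I - X \<noteq> {}" by (auto simp: X_def)
  then show thesis
  proof cases
    case 1
    show thesis
    proof (rule that[of "{x, y} \<union> I" x])
      show "2 \<le> card ({x, y} \<union> I)" using card2[OF xy] IV by blast
      show "(x, w) \<in> ?E" if "w \<in> {x, y} \<union> I - {x}" for w
        using that xy 1 unfolding X_def by blast
      show "{x, y} \<union> I \<subseteq> ?V" using EV[OF xy] IV by blast
    qed (simp, rule rest)
  next
    case 2
    show thesis
    proof (rule that[of "{x, y} \<union> I" y])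
      show "2 \<le> card ({x, y} \<union> I)" using card2[OF xy] IV by blast
      show "(y, w) \<in> ?E" if "w \<in> {x, y} \<union> I - {y}" for w
        using that sym[OF xy] I_y 2 by auto
      show "{x, y} \<union> I \<subseteq> ?V" using EV[OF xy] IV by blast
    qed (simp, rule rest)
  next
    case 3
    then obtain p q where p: "p \<in> X" and q: "q \<in> I - X" by auto
    show thesis
    proof (rule that[of "{x} \<union> X" x])
      show "{x} \<union> X \<subseteq> ?V" using EV[OF xy] IV by (auto simp: X_def)
      have "{x} \<union> X = {x, p} \<union> X" using p by auto
      moreover have "(x, p) \<in> ?E" using p by (simp add: X_def)
      ultimately show "2 \<le> card ({x} \<union> X)"
        using card2[of x p X] \<open>{x} \<union> X \<subseteq> ?V\<close> by auto
      show "(x, w) \<in> ?E" if "w \<in> {x} \<union> X - {x}" for w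
        using that by (auto simp: X_def)
      have qV: "q \<in> ?V - ({x} \<union> X)" and yV: "y \<in> ?V - ({x} \<union> X)"
        using q IV EV[OF xy] irr[OF xy] by (auto simp: X_def)
      \<comment> \<open>\<open>y\<close> keeps the neighbour \<open>q\<close>, what remains of
        \<open>I\<close> keeps the neighbour \<open>y\<close>, and the other vertices are served by
        \<open>other\<close>.\<close>
      have "\<exists>w\<in>?V - ({x} \<union> X). (v, w) \<in> ?E" if v: "v \<in> ?V - ({x} \<union> X)" for v
      proof -
        consider "v = y" | "v \<in> I - X" | "v \<in> ?V - {x, y} - I" using v by auto
        then show ?thesis
        proof cases
          case 1 then show ?thesis using I_y[OF q] qV by blast
        next
          case 2 then show ?thesis using sym[OF I_y] yV by blast
        next
          case 3
          then obtain w where "w \<in> ?V - {x, y} - I" "(v, w) \<in> ?E" using other by blast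
          moreover from this have "w \<notin> {x} \<union> X" by (simp add: X_def)
          ultimately show ?thesis by blast
        qed
      qed
      then show "no_isolated (induced G (?V - ({x} \<union> X)))"
        unfolding no_isolated_def by simp blast
    qed simp
  qed
qed

section \<open>Counting homomorphisms\<close>

lemma finite_homs:
  assumes "finite (pverts G)" "finite (pverts H)"
  shows "finite (homs G H)"
  by (rule finite_subset[of _ "pverts G \<rightarrow>\<^sub>E pverts H"]) (auto simp: homs_def intro: finite_PiE assms)

lemma homs_antimono:
  "pverts G = pverts G' \<Longrightarrow> parcs G' \<subseteq> parcs G \<Longrightarrow> homs G H \<subseteq> homs G' H"
  by (auto simp: homs_def)

lemma restrict_homs:
  assumes "f \<in> homs G H" "A \<subseteq> pverts G"
  shows "restrict f A \<in> homs (induced G A) H"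
  using assms by (auto simp: homs_def)

lemma inj_on_restrict_pair:
  "inj_on (\<lambda>f. (restrict f A, restrict f (V - A))) (V \<rightarrow>\<^sub>E W)"
proof (rule inj_onI)
  fix f g assume fg: "f \<in> V \<rightarrow>\<^sub>E W" "g \<in> V \<rightarrow>\<^sub>E W"
    and eq: "(restrict f A, restrict f (V - A)) = (restrict g A, restrict g (V - A))"
  show "f = g"
  proof (rule PiE_ext[OF fg])
    fix v assume "v \<in> V"
    then have "restrict f A v = restrict g A v" "restrict f (V - A) v = restrict g (V - A) v"
      using eq by auto
    with \<open>v \<in> V\<close> show "f v = g v" by (cases "v \<in> A") auto
  qed
qed

lemma restrict_pair_homs:
  assumes "A \<subseteq> pverts G"
  shows "(\<lambda>f. (restrict f A, restrict f (pverts G - A))) ` homs G H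
    \<subseteq> homs (induced G A) H \<times> homs (induced G (pverts G - A)) H"
  using restrict_homs[of _ G H] assms by auto

lemma card_restrict_pair_homs:
  "card ((\<lambda>f. (restrict f A, restrict f (pverts G - A))) ` homs G H) = hom G H"
  unfolding hom_def
  by (rule card_image, rule inj_on_subset[OF inj_on_restrict_pair[of A "pverts G" "pverts H"]])
    (auto simp: homs_def)

text \<open>Restriction to \<open>A\<close> and to its complement is injective on homomorphisms;
  arcs across the cut are simply forgotten.\<close>

lemma hom_le_product:
  assumes "finite (pverts G)" "finite (pverts H)" "A \<subseteq> pverts G"
  shows "hom G H \<le> hom (induced G A) H * hom (induced G (pverts G - A)) H"
proof -
  have "finite (homs (induced G A) H \<times> homs (induced G (pverts G - A)) H)"
    using assms(1-3) by (intro finite_cartesian_product finite_homs) (auto intro: finite_subset)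
  from card_mono[OF this restrict_pair_homs[OF assms(3)]] show ?thesis
    by (simp add: card_restrict_pair_homs card_cartesian_product) (simp add: hom_def)
qed

text \<open>Equal finite cardinalities make the injective restriction map onto, so the two sides can
  be prescribed independently even if \<open>G\<close> has arcs across the cut. This is how equality
  constrains such arcs.\<close>

lemma glue_homs_if_hom_eq_product:
  assumes "finite (pverts G)" "finite (pverts H)" "A \<subseteq> pverts G"
    and "hom G H = hom (induced G A) H * hom (induced G (pverts G - A)) H"
    and "f \<in> homs (induced G A) H" "g \<in> homs (induced G (pverts G - A)) H"
  obtains h where "h \<in> homs G H" "\<And>v. v \<in> A \<Longrightarrow> h v = f v" "\<And>v. v \<in> pverts G - A \<Longrightarrow> h v = g v"
proof -
  have "finite (homs (induced G A) H \<times> homs (induced G (pverts G - A)) H)"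
    using assms(1-3) by (intro finite_cartesian_product finite_homs) (auto intro: finite_subset)
  from card_subset_eq[OF this restrict_pair_homs[OF assms(3)]]
  have "(\<lambda>f. (restrict f A, restrict f (pverts G - A))) ` homs G H
    = homs (induced G A) H \<times> homs (induced G (pverts G - A)) H"
    using assms(4) by (simp add: card_restrict_pair_homs card_cartesian_product) (simp add: hom_def)
  moreover have "(f, g) \<in> homs (induced G A) H \<times> homs (induced G (pverts G - A)) H"
    using assms by simp
  ultimately obtain h where h: "h \<in> homs G H" "f = restrict h A" "g = restrict h (pverts G - A)"
    by (smt (verit) image_iff prod.inject)
  show thesis by (rule that[OF h(1)]) (simp_all add: h)
qed

text \<open>With no arc across the cut, pasting two homomorphisms always gives a homomorphism, so
  restriction is onto.\<close>

lemma hom_eq_product: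
  assumes "finite (pverts G)" "finite (pverts H)" "A \<subseteq> pverts G"
    and sep: "parcs G \<subseteq> A \<times> A \<union> (pverts G - A) \<times> (pverts G - A)"
  shows "hom G H = hom (induced G A) H * hom (induced G (pverts G - A)) H"
proof -
  have "homs (induced G A) H \<times> homs (induced G (pverts G - A)) H
    \<subseteq> (\<lambda>f. (restrict f A, restrict f (pverts G - A))) ` homs G H"
  proof clarify
    fix f g assume f: "f \<in> homs (induced G A) H" and g: "g \<in> homs (induced G (pverts G - A)) H"
    let ?h = "\<lambda>v. if v \<in> A then f v else g v"
    have "restrict ?h A = f"
      using f by (auto simp: homs_def fun_eq_iff restrict_def PiE_def extensional_def)
    moreover have "restrict ?h (pverts G - A) = g"
      using g by (auto simp: homs_def fun_eq_iff restrict_def PiE_def extensional_def)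
    moreover have "?h \<in> homs G H"
      using f g sep assms(3) by (auto simp: homs_def PiE_def extensional_def Pi_def)
    ultimately show "(f, g) \<in> (\<lambda>f. (restrict f A, restrict f (pverts G - A))) ` homs G H"
      by (metis (no_types, lifting) image_eqI)
  qed
  with restrict_pair_homs[OF assms(3)]
  have "(\<lambda>f. (restrict f A, restrict f (pverts G - A))) ` homs G H
    = homs (induced G A) H \<times> homs (induced G (pverts G - A)) H" by blast
  then show ?thesis
    using card_restrict_pair_homs[of A G H] by (simp add: card_cartesian_product) (simp add: hom_def)
qed

text \<open>Sort the homomorphisms by the image \<open>v\<close> of the centre: each of the
  \<open>card A - 1\<close> leaves then goes independently to a neighbour of \<open>v\<close>, a
  loop making \<open>v\<close> its own neighbour.\<close>

lemma hom_star_graph: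
  assumes "finite A" "x \<in> A" and H: "pair_pseudo_graph H"
  shows "hom (star_graph x A) H = degree_power_sum H (card A - 1)"
proof -
  have fin: "finite (pverts H)" and EV: "\<And>a b. (a, b) \<in> parcs H \<Longrightarrow> a \<in> pverts H \<and> b \<in> pverts H"
    and sym: "\<And>a b. (a, b) \<in> parcs H \<Longrightarrow> (b, a) \<in> parcs H"
    using H by (auto simp: pair_pseudo_graph_iff sym_def)
  let ?F = "\<lambda>v. PiE A (\<lambda>w. if w = x then {v} else {u. (v, u) \<in> parcs H})"
  have "homs (star_graph x A) H = (\<Union>v\<in>pverts H. ?F v)"
  proof (intro equalityI subsetI)
    fix f assume "f \<in> homs (star_graph x A) H"
    with \<open>x \<in> A\<close> have "f \<in> ?F (f x)" "f x \<in> pverts H"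
      by (auto simp: homs_def PiE_def Pi_def)
    then show "f \<in> (\<Union>v\<in>pverts H. ?F v)" by blast
  next
    fix f assume "f \<in> (\<Union>v\<in>pverts H. ?F v)"
    then obtain v where v: "v \<in> pverts H" "f \<in> ?F v" by blast
    then have fx: "f x = v" and fw: "\<And>w. w \<in> A - {x} \<Longrightarrow> (v, f w) \<in> parcs H"
      using \<open>x \<in> A\<close> by (auto simp: PiE_def Pi_def split: if_splits)
    have "f w \<in> pverts H" if "w \<in> A" for w
      using that fx fw[of w] v EV by (cases "w = x") auto
    with v fx fw sym show "f \<in> homs (star_graph x A) H"
      by (auto simp: homs_def PiE_def)
  qed
  moreover have "card (\<Union>v\<in>pverts H. ?F v) = (\<Sum>v\<in>pverts H. card (?F v))"
  proof (rule card_UN_disjoint[OF fin])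
    show "\<forall>v\<in>pverts H. finite (?F v)"
    proof
      fix v
      have "finite {u. (v, u) \<in> parcs H}" by (rule finite_subset[OF _ fin]) (use EV in auto)
      then show "finite (?F v)" by (intro finite_PiE assms(1)) auto
    qed
    show "\<forall>v\<in>pverts H. \<forall>w\<in>pverts H. v \<noteq> w \<longrightarrow> ?F v \<inter> ?F w = {}"
    proof (intro ballI impI equals0I)
      fix v w f assume "v \<noteq> w" and f: "f \<in> ?F v \<inter> ?F w"
      from f have "f \<in> ?F v" "f \<in> ?F w" by blast+
      from PiE_mem[OF this(1) assms(2)] PiE_mem[OF this(2) assms(2)] \<open>v \<noteq> w\<close> show False by simp
    qed
  qed
  moreover have "card (?F v) = degree H v ^ (card A - 1)" for v
  proof -
    have "card (?F v) = (\<Prod>w\<in>A. card (if w = x then {v} else {u. (v, u) \<in> parcs H}))"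
      by (rule card_PiE[OF assms(1)])
    also have "\<dots> = (\<Prod>w\<in>A - {x}. card {u. (v, u) \<in> parcs H})"
      using assms by (subst prod.remove[of A x]) auto
    finally show ?thesis
      using assms by (simp add: degree_eq_card_neighbours)
  qed
  ultimately show ?thesis by (simp add: hom_def degree_power_sum_def)
qed

text \<open>The spanning star at \<open>x\<close> has fewer arcs than \<open>G\<close>, hence at
  least as many homomorphisms.\<close>

lemma hom_le_star:
  assumes "pair_graph G" "pair_pseudo_graph H" "x \<in> pverts G"
    and "\<And>w. w \<in> pverts G - {x} \<Longrightarrow> (x, w) \<in> parcs G"
  shows "hom G H \<le> degree_power_sum H (card (pverts G) - 1)"
proof -
  have fin: "finite (pverts G)" "finite (pverts H)"
    using assms by (simp_all add: pair_graph_iff pair_pseudo_graph_iff)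
  have "parcs (star_graph x (pverts G)) \<subseteq> parcs G"
    using assms(1,4) by (auto simp: pair_graph_iff sym_def)
  then have "homs G H \<subseteq> homs (star_graph x (pverts G)) H"
    by (intro homs_antimono) auto
  then have "hom G H \<le> hom (star_graph x (pverts G)) H"
    unfolding hom_def using fin by (intro card_mono finite_homs) auto
  with hom_star_graph[OF fin(1) assms(3,2)] show ?thesis by simp
qed

section \<open>Isomorphisms, stars and perfect matchings\<close>

text \<open>Arcs are pairs of vertices, so the arc part of an isomorphism is determined by its
  vertex part.\<close>

lemma graph_iso_iff:
  assumes "parcs G \<subseteq> pverts G \<times> pverts G"
  shows "G \<simeq>\<^sub>G K \<longleftrightarrow> (\<exists>f. inj_on f (pverts G) \<and> pverts K = f ` pverts G
    \<and> parcs K = (\<lambda>(u, v). (f u, f v)) ` parcs G)"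
proof
  assume "G \<simeq>\<^sub>G K"
  then obtain i where i: "pre_digraph.digraph_isomorphism (with_proj G) i"
    and K: "with_proj K = app_iso i (with_proj G)" by (auto simp: digraph_iso_def)
  have wf: "wf_digraph (with_proj G)" using i by (simp add: pre_digraph.digraph_isomorphism_def)
  have "verts (with_proj K) = iso_verts i ` pverts G"
    "arcs_ends (with_proj K) = (\<lambda>(u, v). (iso_verts i u, iso_verts i v)) ` parcs G"
    using wf_digraph.arcs_ends_app_iso_eq[OF wf i] by (simp_all only: K verts_app_iso with_proj_simps)
  moreover have "inj_on (iso_verts i) (pverts G)"
    using i by (simp add: pre_digraph.digraph_isomorphism_def)
  ultimately show "\<exists>f. inj_on f (pverts G) \<and> pverts K = f ` pverts G
    \<and> parcs K = (\<lambda>(u, v). (f u, f v)) ` parcs G"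
    by auto
next
  assume "\<exists>f. inj_on f (pverts G) \<and> pverts K = f ` pverts G
    \<and> parcs K = (\<lambda>(u, v). (f u, f v)) ` parcs G"
  then obtain f where f: "inj_on f (pverts G)" "pverts K = f ` pverts G"
    "parcs K = (\<lambda>(u, v). (f u, f v)) ` parcs G" by blast
  \<comment> \<open>Head and tail must again be the projections, since the image has to be of the
    form \<open>with_proj K\<close>.\<close>
  let ?i = "\<lparr>iso_verts = f, iso_arcs = (\<lambda>(u, v). (f u, f v)), iso_head = snd, iso_tail = fst\<rparr>"
  have "wf_digraph (with_proj G)"
    using assms by unfold_locales auto
  moreover have "inj_on (\<lambda>(u, v). (f u, f v)) (parcs G)"
    using inj_on_subset[OF map_prod_inj_on[OF f(1) f(1)] assms] by (simp add: map_prod_def)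
  ultimately have "pre_digraph.digraph_isomorphism (with_proj G) ?i"
    using f(1) by (auto simp: pre_digraph.digraph_isomorphism_def)
  moreover have "with_proj K = app_iso ?i (with_proj G)"
    using f by (simp add: app_iso_def with_proj_def)
  ultimately show "G \<simeq>\<^sub>G K" unfolding digraph_iso_def by blast
qed

text \<open>Composition with the isomorphism and with its inverse are mutually inverse; the
  restrictions keep the maps extensional.\<close>

lemma hom_cong_iso:
  assumes E: "parcs G \<subseteq> pverts G \<times> pverts G" and "G \<simeq>\<^sub>G K"
  shows "hom G H = hom K H"
proof -
  obtain f where f: "inj_on f (pverts G)" "pverts K = f ` pverts G"
    "parcs K = (\<lambda>(u, v). (f u, f v)) ` parcs G"
    using assms(2) unfolding graph_iso_iff[OF E] by blast
  let ?g = "the_inv_into (pverts G) f"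
  have g: "?g (f v) = v" if "v \<in> pverts G" for v
    using that f(1) by (simp add: the_inv_into_f_f)
  have "bij_betw (\<lambda>h. restrict (h \<circ> f) (pverts G)) (homs K H) (homs G H)"
  proof (rule bij_betw_byWitness[where f' = "\<lambda>h. restrict (h \<circ> ?g) (pverts K)"])
    show "\<forall>h\<in>homs K H. restrict (restrict (h \<circ> f) (pverts G) \<circ> ?g) (pverts K) = h"
      using f(2) g by (auto simp: homs_def fun_eq_iff restrict_def PiE_def extensional_def)
    show "\<forall>h\<in>homs G H. restrict (restrict (h \<circ> ?g) (pverts K) \<circ> f) (pverts G) = h"
      using f(2) g by (auto simp: homs_def fun_eq_iff restrict_def PiE_def extensional_def)
    show "(\<lambda>h. restrict (h \<circ> f) (pverts G)) ` homs K H \<subseteq> homs G H"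
    proof clarify
      fix h assume h: "h \<in> homs K H"
      have "(h (f v), h (f w)) \<in> parcs H" if "(v, w) \<in> parcs G" for v w
        using h that f(3) by (force simp: homs_def)
      moreover have "h (f v) \<in> pverts H" if "v \<in> pverts G" for v
        using h that f(2) by (auto simp: homs_def)
      ultimately show "restrict (h \<circ> f) (pverts G) \<in> homs G H"
        using E by (auto simp: homs_def)
    qed
    show "(\<lambda>h. restrict (h \<circ> ?g) (pverts K)) ` homs G H \<subseteq> homs K H"
    proof clarify
      fix h assume h: "h \<in> homs G H"
      have 1: "(h (?g v), h (?g w)) \<in> parcs H \<and> v \<in> pverts K \<and> w \<in> pverts K"
        if vw: "(v, w) \<in> parcs K" for v w
      proof -
        obtain a b where "(a, b) \<in> parcs G" "v = f a" "w = f b" using vw[unfolded f(3)] by auto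
        then show ?thesis using h E f(2) g by (auto simp: homs_def)
      qed
      have 2: "h (?g v) \<in> pverts H" if "v \<in> pverts K" for v
        using h that f(2) g by (auto simp: homs_def)
      show "restrict (h \<circ> ?g) (pverts K) \<in> homs K H"
        using 1 2 by (auto simp: homs_def)
    qed
  qed
  then show ?thesis unfolding hom_def by (metis bij_betw_same_card)
qed

text \<open>Viewing an edge as a star with one leaf lets \<open>hom_star_graph\<close> count both
  kinds of extremal component.\<close>

lemma complete_graph_2_eq_star: "complete_graph 2 = star_graph 0 {..<2}"
  by (auto simp: complete_graph_def star_graph_def)

lemma complete_bipartite_1_eq_star:
  "complete_bipartite_graph 1 k = star_graph (Inl 0) ({..<1} <+> {..<k})"
  by (auto simp: complete_bipartite_graph_def star_graph_def Plus_def)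

lemma hom_complete_graph_2:
  assumes "pair_pseudo_graph H"
  shows "hom (complete_graph 2) H = degree_power_sum H 1"
  unfolding complete_graph_2_eq_star using hom_star_graph[OF _ _ assms, of "{..<2::nat}" 0] by simp

lemma hom_complete_bipartite_1:
  assumes "pair_pseudo_graph H"
  shows "hom (complete_bipartite_graph 1 k) H = degree_power_sum H k"
proof -
  have "hom (complete_bipartite_graph 1 k) H = degree_power_sum H (card ({..<1::nat} <+> {..<k}) - 1)"
    unfolding complete_bipartite_1_eq_star by (rule hom_star_graph) (use assms in auto)
  then show ?thesis by (simp add: card_Plus)
qed

text \<open>The centre is the vertex sent to \<open>Inl 0\<close>; conversely, any enumeration of
  the leaves gives an isomorphism.\<close>

lemma iso_star_iff:
  assumes G: "pair_graph G" and n: "card (pverts G) = Suc k"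
  shows "G \<simeq>\<^sub>G complete_bipartite_graph 1 k \<longleftrightarrow> (\<exists>x\<in>pverts G. G = star_graph x (pverts G))"
proof
  have E: "parcs G \<subseteq> pverts G \<times> pverts G" using G by (simp add: pair_graph_iff)
  assume "G \<simeq>\<^sub>G complete_bipartite_graph 1 k"
  then obtain f where f: "inj_on f (pverts G) \<and> {..<1::nat} <+> {..<k} = f ` pverts G
    \<and> {Inl 0} \<times> (({..<1} <+> {..<k}) - {Inl 0}) \<union> (({..<1} <+> {..<k}) - {Inl 0}) \<times> {Inl 0}
      = (\<lambda>(u, v). (f u, f v)) ` parcs G"
    unfolding graph_iso_iff[OF E] complete_bipartite_1_eq_star star_graph_simps ..
  note inj = conjunct1[OF f] and V = conjunct1[OF conjunct2[OF f]] and P = conjunct2[OF conjunct2[OF f]]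
  have "Inl 0 \<in> f ` pverts G" unfolding V[symmetric] by auto
  then obtain x where x: "x \<in> pverts G" "f x = Inl 0" by auto
  \<comment> \<open>Exactly one end of each arc of the model star is \<open>Inl 0\<close>, and
    injectivity of \<open>f\<close> carries this back to \<open>x\<close>.\<close>
  have 1: "(u = x) \<noteq> (v = x)" if "(u, v) \<in> parcs G" for u v
  proof -
    have "(f u, f v) \<in> (\<lambda>(u, v). (f u, f v)) ` parcs G" using that by force
    then have "(f u = Inl 0) \<noteq> (f v = Inl 0)" unfolding P[symmetric] by auto
    moreover have "u \<in> pverts G" "v \<in> pverts G" using that E by auto
    ultimately show ?thesis using x inj by (metis inj_onD)
  qed
  have 2: "(x, w) \<in> parcs G" if "w \<in> pverts G" "w \<noteq> x" for w
  proof -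
    have "f w \<in> {..<1} <+> {..<k}" using that V by auto
    moreover have "f w \<noteq> Inl 0" using that x inj by (metis inj_onD)
    ultimately have "(f x, f w) \<in> (\<lambda>(u, v). (f u, f v)) ` parcs G"
      unfolding P[symmetric] x by auto
    then obtain a b where "(a, b) \<in> parcs G" "f a = f x" "f b = f w" by auto
    then show ?thesis using inj x(1) that E by (metis SigmaD1 SigmaD2 inj_onD subsetD)
  qed
  have sym: "\<And>a b. (a, b) \<in> parcs G \<Longrightarrow> (b, a) \<in> parcs G" using G by (auto simp: pair_graph_iff sym_def)
  have "parcs G = {x} \<times> (pverts G - {x}) \<union> (pverts G - {x}) \<times> {x}"
  proof (intro equalityI subsetI)
    fix e assume "e \<in> parcs G"
    then show "e \<in> {x} \<times> (pverts G - {x}) \<union> (pverts G - {x}) \<times> {x}"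
      using 1[of "fst e" "snd e"] E by (cases e) auto
  qed (use 2 sym in auto)
  then have "G = star_graph x (pverts G)" by (simp add: star_graph_def)
  with x(1) show "\<exists>x\<in>pverts G. G = star_graph x (pverts G)" by blast
next
  have E: "parcs G \<subseteq> pverts G \<times> pverts G" using G by (simp add: pair_graph_iff)
  assume "\<exists>x\<in>pverts G. G = star_graph x (pverts G)"
  then obtain x where x: "x \<in> pverts G" and "G = star_graph x (pverts G)" by blast
  then have P: "parcs G = {x} \<times> (pverts G - {x}) \<union> (pverts G - {x}) \<times> {x}"
    by (metis star_graph_simps(2))
  have fin: "finite (pverts G)" using G by (simp add: pair_graph_iff)
  have "card (pverts G - {x}) = card {..<k}" using fin x n by simp
  then obtain g where g: "bij_betw g (pverts G - {x}) {..<k}"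
    using fin finite_same_card_bij by blast
  define f where "f v = (if v = x then Inl 0 else Inr (g v) :: nat + nat)" for v
  have inj: "inj_on f (pverts G)"
    using g by (auto simp: inj_on_def bij_betw_def f_def)
  have "f ` (pverts G - {x}) = Inr ` g ` (pverts G - {x})"
    unfolding image_image by (rule image_cong) (auto simp: f_def)
  then have im: "f ` (pverts G - {x}) = Inr ` {..<k}"
    using g by (simp add: bij_betw_def)
  have "f ` pverts G = f ` insert x (pverts G - {x})" using x by (simp add: insert_absorb)
  also have "\<dots> = insert (Inl 0) (Inr ` {..<k})" unfolding image_insert im by (simp add: f_def)
  finally have V: "f ` pverts G = insert (Inl 0) (Inr ` {..<k})" .
  have "(\<lambda>(u, v). (f u, f v)) ` parcs G = {Inl 0} \<times> Inr ` {..<k} \<union> Inr ` {..<k} \<times> {Inl 0}"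
    unfolding P image_Un image_paired_Times im by (simp add: f_def)
  with inj V show "G \<simeq>\<^sub>G complete_bipartite_graph 1 k"
    unfolding graph_iso_iff[OF E]
    by (intro exI[of _ f]) (simp add: complete_bipartite_graph_def Plus_def lessThan_Suc)
qed

text \<open>All degrees equal the number of vertices, which is therefore the maximum degree; any
  bijection of the vertex sets is then an isomorphism.\<close>

lemma iso_complete_looped_graph:
  assumes "pair_pseudo_graph H" "pverts H \<noteq> {}" "pverts H \<times> pverts H \<subseteq> parcs H"
  shows "H \<simeq>\<^sub>G complete_looped_graph (max_degree H)"
proof -
  have fin: "finite (pverts H)" and E: "parcs H = pverts H \<times> pverts H"
    using assms by (auto simp: pair_pseudo_graph_iff)
  have "degree H v = card (pverts H)" if "v \<in> pverts H" for v
    using that by (simp add: degree_eq_card_neighbours E)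
  then have "degree H ` pverts H = {card (pverts H)}" using assms(2) by auto
  then have "max_degree H = card (pverts H)" by (simp add: max_degree_def)
  moreover obtain f where f: "bij_betw f (pverts H) {..<card (pverts H)}"
    using fin finite_same_card_bij[of "pverts H" "{..<card (pverts H)}"] by auto
  moreover have "(\<lambda>(u, v). (f u, f v)) ` (pverts H \<times> pverts H) = f ` pverts H \<times> f ` pverts H"
    by force
  ultimately show ?thesis
    unfolding graph_iso_iff[OF eq_refl[OF E]]
    by (intro exI[of _ f]) (simp add: complete_looped_graph_def bij_betw_def E)
qed

section \<open>Graphs that are perfect matchings\<close>

text \<open>\<open>x\<close> and its partner \<open>y\<close> have no further neighbours, so their
  edge is a component. This is the induction step both for counting homomorphisms and for building
  the isomorphism.\<close>

lemma perfect_matching_remove_edge: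
  assumes G: "pair_graph G" "perfect_matching G" and x: "x \<in> pverts G"
  obtains y where "y \<in> pverts G" "x \<noteq> y" "perfect_matching (induced G (pverts G - {x, y}))"
    "parcs G = {(x, y), (y, x)} \<union> parcs (induced G (pverts G - {x, y}))"
proof -
  have EV: "\<And>a b. (a, b) \<in> parcs G \<Longrightarrow> a \<in> pverts G \<and> b \<in> pverts G"
    and sym: "\<And>a b. (a, b) \<in> parcs G \<Longrightarrow> (b, a) \<in> parcs G"
    and irr: "\<And>a b. (a, b) \<in> parcs G \<Longrightarrow> a \<noteq> b"
    using G(1) by (auto simp: pair_graph_iff sym_def)
  have uniq: "b = c" if "(a, b) \<in> parcs G" "(a, c) \<in> parcs G" for a b c
    using that G(2) EV unfolding perfect_matching_def by blast
  obtain y where xy: "(x, y) \<in> parcs G" using G(2) x by (auto simp: perfect_matching_def)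
  have split: "parcs G = {(x, y), (y, x)} \<union> parcs (induced G (pverts G - {x, y}))"
    (is "_ = ?R")
  proof (rule set_eqI, clarify)
    fix a b
    show "(a, b) \<in> parcs G \<longleftrightarrow> (a, b) \<in> ?R"
      using xy sym uniq EV by (auto; blast)
  qed
  show thesis
  proof (rule that[of y])
    show "perfect_matching (induced G (pverts G - {x, y}))"
      unfolding perfect_matching_def
    proof
      fix v assume "v \<in> pverts (induced G (pverts G - {x, y}))"
      then have v: "v \<in> pverts G" "v \<noteq> x" "v \<noteq> y" by auto
      then obtain w where w: "(v, w) \<in> parcs G" using G(2) by (auto simp: perfect_matching_def)
      then have "w \<noteq> x" "w \<noteq> y" using v xy sym uniq by blast+
      with v w EV show "\<exists>!w. (v, w) \<in> parcs (induced G (pverts G - {x, y}))"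
        by (intro ex1I[of _ w]) (auto intro: uniq)
    qed
  qed (use EV[OF xy] irr[OF xy] split in auto)
qed

lemma hom_perfect_matching:
  assumes "pair_graph G" "perfect_matching G" "pair_pseudo_graph H"
  shows "even (card (pverts G)) \<and> hom G H = degree_power_sum H 1 ^ (card (pverts G) div 2)"
  using assms(1,2)
proof (induction "card (pverts G)" arbitrary: G rule: less_induct)
  case less
  have fin: "finite (pverts G)" "finite (pverts H)"
    using less.prems assms(3) by (simp_all add: pair_graph_iff pair_pseudo_graph_iff)
  show ?case
  proof (cases "pverts G = {}")
    case True
    \<comment> \<open>The empty graph has exactly one extensional map, matching the empty
      product.\<close>
    then have "homs G H = {\<lambda>_. undefined}"
      using less.prems by (auto simp: homs_def pair_graph_iff)
    then show ?thesis using True by (simp add: hom_def)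
  next
    case False
    then obtain x where x: "x \<in> pverts G" by blast
    then obtain y where y: "y \<in> pverts G" "x \<noteq> y"
      and pm: "perfect_matching (induced G (pverts G - {x, y}))"
      and P: "parcs G = {(x, y), (y, x)} \<union> parcs (induced G (pverts G - {x, y}))"
      using perfect_matching_remove_edge[OF less.prems] by metis
    let ?R = "induced G (pverts G - {x, y})"
    have "card {x, y} \<le> card (pverts G)" using x y fin by (intro card_mono) auto
    then have c: "card (pverts G) = 2 + card (pverts ?R)"
      using x y fin by (simp add: card_Diff_subset)
    have "induced G {x, y} = star_graph x {x, y}"
      using y(2) unfolding induced_def star_graph_def by (subst P) auto
    then have "hom (induced G {x, y}) H = degree_power_sum H 1"
      using hom_star_graph[of "{x, y}" x H] assms(3) y(2) by simp
    moreover have "hom G H = hom (induced G {x, y}) H * hom ?R H"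
    proof (rule hom_eq_product[OF fin])
      show "{x, y} \<subseteq> pverts G" using x y by simp
      show "parcs G \<subseteq> {x, y} \<times> {x, y} \<union> (pverts G - {x, y}) \<times> (pverts G - {x, y})"
        by (subst P) auto
    qed
    moreover have "even (card (pverts ?R)) \<and> hom ?R H = degree_power_sum H 1 ^ (card (pverts ?R) div 2)"
      using c by (intro less.hyps pm pair_graph_induced less.prems) auto
    ultimately show ?thesis using c by simp
  qed
qed

lemma iso_disjoint_copies_if_perfect_matching:
  assumes "pair_graph G" "perfect_matching G" "card (pverts G) = 2 * m"
  shows "G \<simeq>\<^sub>G disjoint_copies m (complete_graph 2)"
  using assms
proof (induction m arbitrary: G)
  case 0
  then have "pverts G = {}" "parcs G = {}" by (auto simp: pair_graph_iff)
  then show ?case by (subst graph_iso_iff) (auto simp: disjoint_copies_def)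
next
  case (Suc m)
  have fin: "finite (pverts G)" and E: "parcs G \<subseteq> pverts G \<times> pverts G"
    using Suc.prems by (simp_all add: pair_graph_iff)
  obtain x where x: "x \<in> pverts G" using Suc.prems(3) by fastforce
  then obtain y where y: "y \<in> pverts G" "x \<noteq> y"
    and pm: "perfect_matching (induced G (pverts G - {x, y}))"
    and P: "parcs G = {(x, y), (y, x)} \<union> parcs (induced G (pverts G - {x, y}))"
    using perfect_matching_remove_edge[OF Suc.prems(1,2)] by metis
  let ?R = "induced G (pverts G - {x, y})"
  have "card (pverts ?R) = 2 * m"
    using Suc.prems(3) x y fin by (simp add: card_Diff_subset)
  with Suc.IH[OF pair_graph_induced[OF Suc.prems(1)] pm]
  have "?R \<simeq>\<^sub>G disjoint_copies m (complete_graph 2)" by auto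
  then obtain f where f: "inj_on f (pverts G - {x, y})"
    "{..<m} \<times> {..<2} = f ` (pverts G - {x, y})"
    "parcs (disjoint_copies m (complete_graph 2)) = (\<lambda>(u, v). (f u, f v)) ` parcs ?R"
    by (subst (asm) graph_iso_iff) (auto simp: disjoint_copies_def complete_graph_def)
  \<comment> \<open>The removed edge becomes copy number \<open>m\<close>; \<open>f\<close> only
    uses the copies below \<open>m\<close>, so injectivity is preserved.\<close>
  define g where "g = f(x := (m, 0), y := (m, 1))"
  have g: "g x = (m, 0)" "g y = (m, 1)" "\<And>v. v \<in> pverts G - {x, y} \<Longrightarrow> g v = f v"
    using y(2) by (auto simp: g_def)
  have fm: "fst (f v) < m" if "v \<in> pverts G - {x, y}" for v
  proof -
    have "f v \<in> {..<m} \<times> {..<2}" unfolding f(2) using that by (rule imageI)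
    then show ?thesis by auto
  qed
  have V: "pverts G = insert x (insert y (pverts G - {x, y}))" using x y by auto
  have "inj_on g (pverts G)"
  proof (rule inj_onI)
    fix a b assume ab: "a \<in> pverts G" "b \<in> pverts G" "g a = g b"
    have *: "c = x \<or> c = y \<or> c \<in> pverts G - {x, y} \<and> fst (g c) < m" if "c \<in> pverts G" for c
      using that fm[of c] g(3)[of c] by auto
    show "a = b"
    proof (cases "a \<in> pverts G - {x, y} \<and> b \<in> pverts G - {x, y}")
      case True
      then show ?thesis using ab(3) f(1) g(3) by (metis inj_onD)
    next
      case False
      moreover have "fst (g x) = m" "fst (g y) = m" "g x \<noteq> g y" using g(1,2) by simp_all
      ultimately show ?thesis using *[OF ab(1)] *[OF ab(2)] ab(3) by (metis less_irrefl)
    qed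
  qed
  moreover have "g ` pverts G = {..<Suc m} \<times> {..<2}"
  proof -
    have "g ` (pverts G - {x, y}) = f ` (pverts G - {x, y})"
      using g(3) by (rule image_cong[OF refl])
    then have "g ` pverts G = insert (m, 0) (insert (m, 1) ({..<m} \<times> {..<2}))"
      unfolding f(2) using g(1,2) by (subst V) simp
    also have "\<dots> = {..<Suc m} \<times> {..<2}" by (auto simp: less_Suc_eq numeral_2_eq_2)
    finally show ?thesis .
  qed
  moreover have "(\<lambda>(u, v). (g u, g v)) ` parcs G = parcs (disjoint_copies (Suc m) (complete_graph 2))"
  proof -
    have "(\<lambda>(u, v). (g u, g v)) ` parcs ?R = (\<lambda>(u, v). (f u, f v)) ` parcs ?R"
      by (rule image_cong) (auto simp: g(3))
    then have "(\<lambda>(u, v). (g u, g v)) ` parcs G = {((m, 0), (m, 1)), ((m, 1), (m, 0))}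
        \<union> parcs (disjoint_copies m (complete_graph 2))"
      using g(1,2) unfolding f(3) by (subst P) (simp add: image_Un del: induced_simps)
    also have "\<dots> = parcs (disjoint_copies (Suc m) (complete_graph 2))"
      by (auto simp: disjoint_copies_def complete_graph_def less_Suc_eq numeral_2_eq_2)
    finally show ?thesis .
  qed
  ultimately have "inj_on g (pverts G) \<and> pverts (disjoint_copies (Suc m) (complete_graph 2)) = g ` pverts G
    \<and> parcs (disjoint_copies (Suc m) (complete_graph 2)) = (\<lambda>(u, v). (g u, g v)) ` parcs G"
    by (simp add: disjoint_copies_def complete_graph_def)
  then show ?case unfolding graph_iso_iff[OF E] by blast
qed

lemma perfect_matching_if_iso_disjoint_copies:
  assumes "pair_graph G" "G \<simeq>\<^sub>G disjoint_copies m (complete_graph 2)"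
  shows "perfect_matching G"
proof -
  let ?K = "disjoint_copies m (complete_graph 2)"
  have E: "parcs G \<subseteq> pverts G \<times> pverts G" using assms by (simp add: pair_graph_iff)
  obtain f where f: "inj_on f (pverts G)" "pverts ?K = f ` pverts G"
    "parcs ?K = (\<lambda>(u, v). (f u, f v)) ` parcs G"
    using assms(2) unfolding graph_iso_iff[OF E] by blast
  have K: "\<exists>!q. (p, q) \<in> parcs ?K" if "p \<in> pverts ?K" for p
  \<comment> \<open>The partner lies in the same copy and has the other of the two labels 0 and
    1.\<close>
  proof (rule ex1I[of _ "(fst p, 1 - snd p)"])
    show "(p, (fst p, 1 - snd p)) \<in> parcs ?K"
      using that by (auto simp: disjoint_copies_def complete_graph_def) arith
    show "q = (fst p, 1 - snd p)" if "(p, q) \<in> parcs ?K" for q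
      using that by (auto simp: disjoint_copies_def complete_graph_def)
  qed
  show ?thesis
    unfolding perfect_matching_def
  proof
    fix v assume v: "v \<in> pverts G"
    then have *: "\<exists>!q. (f v, q) \<in> parcs ?K" using f(2) K by blast
    then obtain q where "(f v, q) \<in> (\<lambda>(u, v). (f u, f v)) ` parcs G" using f(3) by metis
    then obtain a b where ab: "(a, b) \<in> parcs G" "f a = f v" "q = f b" by auto
    then have "(v, b) \<in> parcs G" using f(1) v E by (metis SigmaD1 inj_onD subsetD)
    moreover have "w = b" if "(v, w) \<in> parcs G" for w
    proof -
      have "(f v, f w) \<in> parcs ?K" "(f v, f b) \<in> parcs ?K"
        unfolding f(3) using that \<open>(v, b) \<in> parcs G\<close> by force+
      then have "f w = f b" using * by blast
      then show ?thesis using f(1) that ab(1) E by (metis SigmaD2 inj_onD subsetD)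
    qed
    ultimately show "\<exists>!w. (v, w) \<in> parcs G" by blast
  qed
qed

section \<open>Strictly convex sequences\<close>

text \<open>Increments increase strictly. If \<open>u\<close> failed to rise at some
  \<open>i\<close> with \<open>1 \<le> i\<close>, all earlier increments would be negative and,
  summed from \<open>u 0 = 0\<close>, would give \<open>u i < 0\<close>. So \<open>u\<close> rises
  forever once it is nonnegative at a positive index.\<close>

lemma strictly_convex_increasing:
  fixes u :: "nat \<Rightarrow> real"
  assumes u0: "u 0 = 0" and conv: "\<And>j. 2 * u (Suc j) < u j + u (Suc (Suc j))"
    and j: "1 \<le> j" "0 \<le> u j" and "j < k"
  shows "u j < u k"
proof -
  let ?\<delta> = "\<lambda>i. u (Suc i) - u i"
  have mono: "?\<delta> i < ?\<delta> l" if "i < l" for i l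
  proof (rule lift_Suc_mono_less[OF _ that, of ?\<delta>])
    show "?\<delta> n < ?\<delta> (Suc n)" for n using conv[of n] by simp
  qed
  have step: "u i < u (Suc i)" if "1 \<le> i" "0 \<le> u i" for i
  proof (rule ccontr)
    assume "\<not> u i < u (Suc i)"
    then have "?\<delta> l < 0" if "l \<in> {..<i}" for l
      using mono[of l i] that by simp
    then have "sum ?\<delta> {..<i} < (\<Sum>l<i. 0)"
      using that(1) by (intro sum_strict_mono) (auto simp: lessThan_empty_iff bot_nat_def)
    with that u0 show False by (simp add: sum_lessThan_telescope)
  qed
  from \<open>j < k\<close> show ?thesis
  proof (induction k)
    case (Suc k)
    then show ?case using step[of j] step[of k] j by (cases "j = k") auto
  qed simp
qed

text \<open>The increment at \<open>i + j\<close> is at least the one at \<open>j\<close>; summing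
  over \<open>j\<close> gives the claim.\<close>

lemma strictly_convex_superadditive:
  fixes u :: "nat \<Rightarrow> real"
  assumes u0: "u 0 = 0" and conv: "\<And>j. 2 * u (Suc j) < u j + u (Suc (Suc j))"
  shows "u i + u j \<le> u (i + j)"
proof (induction j)
  case (Suc j)
  have "u (Suc j) - u j \<le> u (Suc (i + j)) - u (i + j)"
  proof (rule lift_Suc_mono_le[of "\<lambda>i. u (Suc i) - u i"])
    show "u (Suc n) - u n \<le> u (Suc (Suc n)) - u (Suc n)" for n using conv[of n] by simp
  qed simp
  with Suc show ?case by simp
qed (simp add: u0)

text \<open>Stars on \<open>i + 2\<close> and \<open>j + 2\<close> vertices compete with one star on
  \<open>i + j + 4\<close> vertices, whose excess has index \<open>i + j + 2\<close>. The two extra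
  steps make the inequality strict as soon as one summand is positive.\<close>

lemma strictly_convex_positive_part:
  fixes u :: "nat \<Rightarrow> real"
  assumes u0: "u 0 = 0" and conv: "\<And>j. 2 * u (Suc j) < u j + u (Suc (Suc j))"
  shows "max 0 (u i) + max 0 (u j) \<le> max 0 (u (i + j + 2))"
    and "0 < u (i + j + 2) \<Longrightarrow> max 0 (u i) + max 0 (u j) < u (i + j + 2)"
proof -
  note inc = strictly_convex_increasing[OF u0 conv]
  have pos: "1 \<le> l" if "0 < u l" for l using that u0 by (cases l) auto
  have *: "max 0 (u i) + max 0 (u j) < u (i + j + 2)" if "0 < u i \<or> 0 < u j"
  proof (cases "0 < u i \<and> 0 < u j")
    case True
    then have "0 < u (i + j)" "u i + u j \<le> u (i + j)"
      using strictly_convex_superadditive[OF u0 conv, of i j] by auto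
    with True inc[of "i + j" "i + j + 2"] pos[of "i + j"] show ?thesis by auto
  next
    case False
    with that inc[of i "i + j + 2"] inc[of j "i + j + 2"] pos show ?thesis by force
  qed
  show "max 0 (u i) + max 0 (u j) \<le> max 0 (u (i + j + 2))"
    using * by (cases "0 < u i \<or> 0 < u j") auto
  show "max 0 (u i) + max 0 (u j) < u (i + j + 2)" if "0 < u (i + j + 2)"
    using * that by (cases "0 < u i \<or> 0 < u j") auto
qed

section \<open>Degree power sums of the target\<close>

locale target_graph =
  fixes H :: "'h pair_pre_digraph"
  assumes pseudo: "pair_pseudo_graph H" and nonempty: "pverts H \<noteq> {}" and noiso: "no_isolated H"
begin

abbreviation S :: "nat \<Rightarrow> real"
  where "S k \<equiv> real (degree_power_sum H k)"

text \<open>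
  \<open>star_excess (m - 2)\<close> is the logarithm of the ratio of \<open>hom(K\<^bsub>1,m-1\<^esub>, H)\<close> to
  \<open>hom(K\<^sub>2, H)\<close> raised to the power \<open>m/2\<close>; the shift makes the sequence start at \<open>0\<close> with value \<open>0\<close>.
\<close>

definition star_excess :: "nat \<Rightarrow> real"
  where "star_excess j = ln (S (j + 1)) - real (j + 2) / 2 * ln (S 1)"

lemma finite_pverts: "finite (pverts H)"
  and arc_in_pverts: "(v, w) \<in> parcs H \<Longrightarrow> v \<in> pverts H \<and> w \<in> pverts H"
  and arc_sym: "(v, w) \<in> parcs H \<Longrightarrow> (w, v) \<in> parcs H"
  using pseudo by (auto simp: pair_pseudo_graph_iff sym_def)

lemma finite_neighbours: "finite {w. (v, w) \<in> parcs H}"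
  by (rule finite_subset[OF _ finite_pverts]) (use arc_in_pverts in auto)

lemma degree_pos: "v \<in> pverts H \<Longrightarrow> 1 \<le> degree H v"
  using noiso finite_neighbours[of v]
  by (auto simp: no_isolated_def degree_eq_card_neighbours Suc_le_eq card_gt_0_iff)

lemma degree_le_card: "degree H v \<le> card (pverts H)"
  unfolding degree_eq_card_neighbours
  by (rule card_mono[OF finite_pverts]) (use arc_in_pverts in auto)

lemma degree_le_max_degree: "v \<in> pverts H \<Longrightarrow> degree H v \<le> max_degree H"
  unfolding max_degree_def using finite_pverts by (intro Max_ge) auto

lemma max_degree_attained: obtains v where "v \<in> pverts H" "degree H v = max_degree H"
  using Max_in[of "degree H ` pverts H"] finite_pverts nonempty unfolding max_degree_def by fastforce

lemma max_degree_pos: "1 \<le> max_degree H"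
  using max_degree_attained degree_pos by metis

lemma power_max_degree_le: "max_degree H ^ k \<le> degree_power_sum H k"
proof -
  obtain v where v: "v \<in> pverts H" "degree H v = max_degree H" by (rule max_degree_attained)
  show ?thesis unfolding degree_power_sum_def v(2)[symmetric]
    using v(1) finite_pverts by (intro member_le_sum) auto
qed

lemma S_pos: "0 < S k"
proof -
  have "1 \<le> max_degree H ^ k" using max_degree_pos by simp
  with power_max_degree_le[of k] show ?thesis by linarith
qed

text \<open>The sign of the excess thus decides whether one star on \<open>m\<close> vertices beats
  the value \<open>S 1 powr (m / 2)\<close> that disjoint edges would give.\<close>

lemma S_eq_exp_star_excess: "2 \<le> m \<Longrightarrow> S (m - 1) = S 1 powr (real m / 2) * exp (star_excess (m - 2))"
proof -
  assume "2 \<le> m"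
  then obtain j where j: "m = j + 2" by (metis add.commute le_Suc_ex)
  show ?thesis
    unfolding j using S_pos[of "j + 1"] S_pos[of 1] by (simp add: star_excess_def powr_def flip: exp_add)
qed

lemma regular_complete:
  assumes "\<And>v. v \<in> pverts H \<Longrightarrow> degree H v = card (pverts H)"
  shows "pverts H \<times> pverts H \<subseteq> parcs H"
proof clarify
  fix v w assume "v \<in> pverts H" "w \<in> pverts H"
  have "{w. (v, w) \<in> parcs H} = pverts H"
    using assms[OF \<open>v \<in> pverts H\<close>] arc_in_pverts finite_pverts
    by (intro card_subset_eq) (auto simp: degree_eq_card_neighbours)
  with \<open>w \<in> pverts H\<close> show "(v, w) \<in> parcs H" by blast
qed

text \<open>One of the two estimates is strict. A vertex of degree below \<Delta> makes the termwise
  bound by \<Delta> strict. If instead \<open>H\<close> is regular but not complete with loops, it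
  has more than \<Delta> vertices, so \<open>S 1\<close> exceeds the square of \<Delta>.\<close>

lemma S_less_powr_if_max_degree_le:
  assumes D: "(max_degree H)\<^sup>2 \<le> degree_power_sum H 1" and "\<not> pverts H \<times> pverts H \<subseteq> parcs H"
    and "3 \<le> m"
  shows "S (m - 1) < S 1 powr (real m / 2)"
proof -
  let ?D = "max_degree H"
  \<comment> \<open>Of the \<open>m - 1 = k + 2\<close> factors in each summand, one is kept to form
    \<open>S 1\<close> and \<open>k + 1\<close> are bounded by \<Delta>; this exponent is positive,
    as strictness requires.\<close>
  define k where "k = m - 3"
  have m: "m = k + 3" using assms(3) by (simp add: k_def)
  have D0: "0 < real ?D" using max_degree_pos by simp
  have Dpow: "real ?D ^ (k + 1) = (real ?D ^ 2) powr (real (k + 1) / 2)"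
  proof -
    have "(real ?D ^ 2) powr (real (k + 1) / 2) = (real ?D powr real 2) powr (real (k + 1) / 2)"
      using D0 by (simp only: powr_realpow)
    also have "\<dots> = real ?D powr real (k + 1)"
      unfolding powr_powr by (rule arg_cong) simp
    also have "\<dots> = real ?D ^ (k + 1)" using D0 by (simp only: powr_realpow)
    finally show ?thesis by simp
  qed
  have split: "S 1 powr (real m / 2) = S 1 * S 1 powr (real (k + 1) / 2)"
  proof -
    have "S 1 powr (real m / 2) = S 1 powr (1 + real (k + 1) / 2)"
      by (rule arg_cong) (simp add: m field_simps)
    also have "\<dots> = S 1 * S 1 powr (real (k + 1) / 2)"
      using S_pos[of 1] by (subst powr_add) simp
    finally show ?thesis .
  qed
  have Dle: "real ?D ^ 2 \<le> S 1" using D by (metis of_nat_le_iff of_nat_power)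
  have le: "real ?D ^ (k + 1) \<le> S 1 powr (real (k + 1) / 2)"
    unfolding Dpow using Dle by (intro powr_mono2) auto
  have sum: "S (m - 1) = (\<Sum>v\<in>pverts H. real (degree H v) * real (degree H v) ^ (k + 1))"
    by (simp add: degree_power_sum_def m)
  have S1: "S 1 * real ?D ^ (k + 1) = (\<Sum>v\<in>pverts H. real (degree H v) * real ?D ^ (k + 1))"
    by (simp add: degree_power_sum_def sum_distrib_right)
  have term_le: "real (degree H v) * real (degree H v) ^ (k + 1) \<le> real (degree H v) * real ?D ^ (k + 1)"
    if "v \<in> pverts H" for v
    using degree_le_max_degree[OF that] by (intro mult_left_mono power_mono) auto
  show ?thesis
  proof (cases "\<exists>v\<in>pverts H. degree H v < ?D")
    case True
    then obtain v where v: "v \<in> pverts H" "degree H v < ?D" by blast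
    have "real (degree H v) * real (degree H v) ^ (k + 1) < real (degree H v) * real ?D ^ (k + 1)"
      using v degree_pos[OF v(1)] by (intro mult_strict_left_mono power_strict_mono) auto
    then have "S (m - 1) < S 1 * real ?D ^ (k + 1)"
      unfolding sum S1 using v(1) term_le finite_pverts by (intro sum_strict_mono_ex1) auto
    also have "\<dots> \<le> S 1 * S 1 powr (real (k + 1) / 2)"
      using le by (intro mult_left_mono) auto
    finally show ?thesis unfolding split .
  next
    case False
    then have reg: "degree H v = ?D" if "v \<in> pverts H" for v
      using that degree_le_max_degree[OF that] by force
    then have "degree_power_sum H 1 = card (pverts H) * ?D" by (simp add: degree_power_sum_def)
    moreover have "card (pverts H) \<noteq> ?D" using regular_complete reg assms(2) by metis
    ultimately have "?D\<^sup>2 \<noteq> degree_power_sum H 1"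
      using D0 by (simp add: power2_eq_square)
    with D have "?D\<^sup>2 < degree_power_sum H 1" by simp
    then have "real ?D ^ 2 < S 1" by (metis of_nat_less_iff of_nat_power)
    then have "real ?D ^ (k + 1) < S 1 powr (real (k + 1) / 2)"
      unfolding Dpow by (intro powr_less_mono2) auto
    then have "S 1 * real ?D ^ (k + 1) < S 1 * S 1 powr (real (k + 1) / 2)"
      using S_pos[of 1] by (intro mult_strict_left_mono)
    moreover have "S (m - 1) \<le> S 1 * real ?D ^ (k + 1)"
      unfolding sum S1 by (intro sum_mono term_le)
    ultimately show ?thesis unfolding split by simp
  qed
qed

lemma star_excess_0: "star_excess 0 = 0" by (simp add: star_excess_def)

text \<open>Lagrange's identity: twice the difference of the two sides is a sum over pairs
  \<open>(v, w)\<close> of nonnegative terms with factor \<open>(?d v - ?d w)\<^sup>2\<close>. The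
  given pair contributes a positive term since degrees are positive.\<close>

lemma S_log_convex:
  assumes "v\<^sub>0 \<in> pverts H" "w\<^sub>0 \<in> pverts H" "degree H v\<^sub>0 \<noteq> degree H w\<^sub>0"
  shows "(S (k + 1))\<^sup>2 < S k * S (k + 2)"
proof -
  let ?P = "pverts H" and ?d = "\<lambda>v. real (degree H v)"
  let ?t = "\<lambda>(v, w). ?d v ^ k * ?d w ^ k * (?d v - ?d w)\<^sup>2"
  have "0 < sum ?t (?P \<times> ?P)"
  proof (rule sum_pos2)
    show "(v\<^sub>0, w\<^sub>0) \<in> ?P \<times> ?P" using assms by simp
    show "0 < ?t (v\<^sub>0, w\<^sub>0)" using assms degree_pos[of v\<^sub>0] degree_pos[of w\<^sub>0] by simp
  qed (use finite_pverts in auto)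
  also have "sum ?t (?P \<times> ?P) = (\<Sum>v\<in>?P. \<Sum>w\<in>?P. ?d v ^ (k + 2) * ?d w ^ k
      + ?d v ^ k * ?d w ^ (k + 2) - 2 * (?d v ^ (k + 1) * ?d w ^ (k + 1)))"
    by (subst sum.cartesian_product[symmetric])
      (intro sum.cong refl, simp add: power2_eq_square algebra_simps)
  also have "\<dots> = 2 * (S k * S (k + 2) - (S (k + 1))\<^sup>2)"
    by (simp add: degree_power_sum_def sum.distrib sum_subtractf sum_distrib_left[symmetric]
        sum_distrib_right[symmetric] power2_eq_square)
  finally show ?thesis by simp
qed

text \<open>
  The matching edge at \<open>p\<close> and the one at \<open>z\<close> can be mapped independently, so that \<open>p\<close> and \<open>z\<close> take
  every pair of values; since they are adjacent, every pair is an arc of \<open>H\<close>.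
\<close>

lemma complete_if_hom_eq_product:
  assumes "pair_graph G" "A = {p, q}" "p \<noteq> q" "A \<subseteq> pverts G" "perfect_matching (induced G (pverts G - A))"
    and eq: "hom G H = hom (induced G A) H * hom (induced G (pverts G - A)) H" and "hom G H \<noteq> 0"
    and "(p, z) \<in> parcs G" "z \<notin> A"
  shows "pverts H \<times> pverts H \<subseteq> parcs H"
proof clarify
  fix c d assume "c \<in> pverts H" "d \<in> pverts H"
  let ?R = "induced G (pverts G - A)"
  have fin: "finite (pverts G)" and EV: "\<And>a b. (a, b) \<in> parcs G \<Longrightarrow> a \<in> pverts G \<and> b \<in> pverts G"
    and sym: "\<And>a b. (a, b) \<in> parcs G \<Longrightarrow> (b, a) \<in> parcs G"
    and irr: "\<And>a b. (a, b) \<in> parcs G \<Longrightarrow> a \<noteq> b"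
    using assms(1) by (auto simp: pair_graph_iff sym_def)
  obtain c' where c': "(c, c') \<in> parcs H" using \<open>c \<in> pverts H\<close> noiso by (auto simp: no_isolated_def)
  obtain d' where d': "(d, d') \<in> parcs H" using \<open>d \<in> pverts H\<close> noiso by (auto simp: no_isolated_def)
  let ?f = "\<lambda>v. if v = p then c else if v = q then c' else undefined"
  have f: "?f \<in> homs (induced G A) H"
    using assms(2,3) c' arc_sym[OF c'] arc_in_pverts[OF c'] irr by (auto simp: homs_def)
  have z: "z \<in> pverts ?R" using assms(8,9) EV by auto
  then obtain z' where z': "(z, z') \<in> parcs ?R"
    using assms(5) unfolding perfect_matching_def by blast
  have pm: "b = b'" if "(a, b) \<in> parcs ?R" "(a, b') \<in> parcs ?R" for a b b'
  proof -
    have "a \<in> pverts ?R" using that by auto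
    then show ?thesis using assms(5) that unfolding perfect_matching_def by blast
  qed
  have z'z: "(z', z) \<in> parcs ?R" using z' sym by auto
  have "homs ?R H \<noteq> {}" using eq assms(7) by (auto simp: hom_def)
  then obtain g where g: "g \<in> homs ?R H" by blast
  \<comment> \<open>The edge between \<open>z\<close> and \<open>z'\<close> is a component of the
    remainder, so changing \<open>g\<close> on this edge alone keeps a homomorphism.\<close>
  let ?g = "g(z := d, z' := d')"
  have ne: "z' \<noteq> z" using irr z' by auto
  have "?g \<in> homs ?R H"
    unfolding homs_def
  proof (intro CollectI conjI allI impI)
    show "?g \<in> pverts ?R \<rightarrow>\<^sub>E pverts H"
      using g z z' arc_in_pverts[OF d'] by (auto simp: homs_def PiE_def extensional_def Pi_def)
    fix v w assume vw: "(v, w) \<in> parcs ?R"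
    then have wv: "(w, v) \<in> parcs ?R" using sym by auto
    consider "v = z" "w = z'" | "v = z'" "w = z" | "v \<notin> {z, z'}" "w \<notin> {z, z'}"
      using pm vw wv z' z'z by blast
    then show "(?g v, ?g w) \<in> parcs H"
    proof cases
      case 3 then show ?thesis using g vw by (auto simp: homs_def)
    qed (use d' arc_sym ne in auto)
  qed
  then obtain h where h: "h \<in> homs G H" "\<And>v. v \<in> A \<Longrightarrow> h v = ?f v"
    "\<And>v. v \<in> pverts G - A \<Longrightarrow> h v = ?g v"
    using glue_homs_if_hom_eq_product[OF fin finite_pverts assms(4) eq f] by blast
  have "h p = c" "h z = d" using h(2)[of p] h(3)[of z] z assms(2) ne by auto
  then show "(c, d) \<in> parcs H" using h(1) assms(8) by (auto simp: homs_def)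
qed

section \<open>Bounds obtained by splitting off stars\<close>

text \<open>A case rule for inductions on \<open>G\<close>: either one star spans \<open>G\<close>,
  or a star on \<open>A\<close> splits off and leaves a smaller nonempty graph without isolated
  vertices.\<close>

lemma hom_star_decomposition:
  assumes G: "pair_graph G" "no_isolated G" "pverts G \<noteq> {}"
  obtains (star) x where "x \<in> pverts G" "\<And>w. w \<in> pverts G - {x} \<Longrightarrow> (x, w) \<in> parcs G"
      "hom G H \<le> degree_power_sum H (card (pverts G) - 1)"
    | (split) A where "A \<subseteq> pverts G" "2 \<le> card A" "2 \<le> card (pverts G - A)"
      "card (pverts G) = card A + card (pverts G - A)"
      "no_isolated (induced G (pverts G - A))" "pair_graph (induced G (pverts G - A))"
      "hom (induced G A) H \<le> degree_power_sum H (card A - 1)"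
      "hom G H \<le> hom (induced G A) H * hom (induced G (pverts G - A)) H"
proof -
  have fin: "finite (pverts G)" using G(1) by (simp add: pair_graph_iff)
  obtain A x where A: "A \<subseteq> pverts G" "x \<in> A" "2 \<le> card A"
    "\<And>w. w \<in> A - {x} \<Longrightarrow> (x, w) \<in> parcs G" "no_isolated (induced G (pverts G - A))"
    using star_decomposition[OF G] by metis
  show thesis
  proof (cases "A = pverts G")
    case True
    with A star[of x] hom_le_star[OF G(1) pseudo] show thesis by auto
  next
    case False
    have R: "pair_graph (induced G (pverts G - A))" using G(1) by (rule pair_graph_induced) auto
    have "hom (induced G A) H \<le> degree_power_sum H (card A - 1)"
      using hom_le_star[OF pair_graph_induced[OF G(1) A(1)] pseudo, of x] A(1,2,4) by auto
    moreover have "2 \<le> card (pverts G - A)"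
      using card_ge_2_no_isolated[OF R A(5)] False A(1)
      by (metis Diff_eq_empty_iff induced_simps(1) subset_antisym)
    moreover have "card (pverts G) = card A + card (pverts G - A)"
      using A(1) fin by (metis card_Diff_subset card_mono finite_subset le_add_diff_inverse)
    ultimately show thesis
      using split A R hom_le_product[OF fin finite_pverts A(1)] by blast
  qed
qed

text \<open>Splitting off stars repeatedly bounds \<open>hom G H\<close> by a product of star
  counts, which supermultiplicativity of \<open>M\<close> collapses to a single value. The limit
  \<open>n\<close> asks for the bounds only at sizes that can occur in \<open>G\<close>, which
  matters below \<open>n0 H\<close>.\<close>

lemma hom_le_supermultiplicative:
  fixes M :: "nat \<Rightarrow> real"
  assumes M: "\<And>a. 2 \<le> a \<Longrightarrow> a \<le> n \<Longrightarrow> S (a - 1) \<le> M a"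
    "\<And>a b. 2 \<le> a \<Longrightarrow> 2 \<le> b \<Longrightarrow> a + b \<le> n \<Longrightarrow> M a * M b \<le> M (a + b)"
    and G: "pair_graph G" "no_isolated G" "pverts G \<noteq> {}" and "card (pverts G) \<le> n"
  shows "hom G H \<le> M (card (pverts G))"
  using G \<open>card (pverts G) \<le> n\<close>
proof (induction "card (pverts G)" arbitrary: G rule: less_induct)
  case less
  from less.prems(1-3) show ?case
  proof (cases rule: hom_star_decomposition)
    case (star x)
    have "real (hom G H) \<le> S (card (pverts G) - 1)" using star(3) by simp
    also have "\<dots> \<le> M (card (pverts G))"
      using card_ge_2_no_isolated[OF less.prems(1-3)] less.prems(4) by (rule M(1))
    finally show ?thesis .
  next
    case (split A)
    let ?R = "induced G (pverts G - A)"
    have "hom ?R H \<le> M (card (pverts ?R))"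
      using split less.prems(4) by (intro less.hyps) auto
    moreover have "S (card A - 1) \<le> M (card A)"
      using split(2,4) less.prems(4) by (intro M(1)) auto
    then have "hom (induced G A) H \<le> M (card A)"
      using of_nat_mono[OF split(7), where 'a = real] by (rule order.trans[rotated])
    ultimately have "real (hom (induced G A) H) * real (hom ?R H) \<le> M (card A) * M (card (pverts ?R))"
      by (intro mult_mono) auto
    also have "\<dots> \<le> M (card (pverts G))"
      using M(2)[of "card A" "card (pverts ?R)"] split less.prems(4) by simp
    finally show ?thesis using of_nat_mono[OF split(8), where 'a = real] by simp
  qed
qed

lemma hom_le_edges:
  assumes le: "\<And>m. 3 \<le> m \<Longrightarrow> m \<le> card (pverts G) \<Longrightarrow> S (m - 1) \<le> S 1 powr (real m / 2)"
    and G: "pair_graph G" "no_isolated G" "pverts G \<noteq> {}"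
  shows "hom G H \<le> S 1 powr (real (card (pverts G)) / 2)"
proof (rule hom_le_supermultiplicative[OF _ _ G order_refl])
  fix a assume a: "2 \<le> a" "a \<le> card (pverts G)"
  show "S (a - 1) \<le> S 1 powr (real a / 2)"
  \<comment> \<open>A star on two vertices is an edge, and the bound is an equality.\<close>
  proof (cases "a = 2")
    case False then show ?thesis using a le[of a] by simp
  qed (simp add: S_pos)
qed (simp add: powr_add[symmetric] add_divide_distrib)

text \<open>In an extremal split the star must be a single edge and the remainder must be extremal.
  By induction the remainder is a matching, and an arc joining it to the edge would make
  \<open>H\<close> complete with loops. The other outcome is a spanning star whose count ties with
  the edge bound.\<close>

lemma hom_eq_edges_cases:
  assumes less: "\<And>m. 3 \<le> m \<Longrightarrow> m < card (pverts G) \<Longrightarrow> S (m - 1) < S 1 powr (real m / 2)"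
    and le: "3 \<le> card (pverts G) \<Longrightarrow> S (card (pverts G) - 1) \<le> S 1 powr (real (card (pverts G)) / 2)"
    and nc: "\<not> pverts H \<times> pverts H \<subseteq> parcs H"
    and G: "pair_graph G" "no_isolated G" "pverts G \<noteq> {}"
    and eq: "hom G H = S 1 powr (real (card (pverts G)) / 2)"
  shows "perfect_matching G \<or> 3 \<le> card (pverts G)
    \<and> S (card (pverts G) - 1) = S 1 powr (real (card (pverts G)) / 2)
    \<and> hom G H = degree_power_sum H (card (pverts G) - 1)
    \<and> (\<exists>x\<in>pverts G. \<forall>w\<in>pverts G - {x}. (x, w) \<in> parcs G)"
  using less le G eq
proof (induction "card (pverts G)" arbitrary: G rule: less_induct)
  case less
  note less' = less.prems(1) and le = less.prems(2) and G = less.prems(3-5) and eq = less.prems(6)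
  have fin: "finite (pverts G)" and EV: "\<And>a b. (a, b) \<in> parcs G \<Longrightarrow> a \<in> pverts G \<and> b \<in> pverts G"
    and sym: "\<And>a b. (a, b) \<in> parcs G \<Longrightarrow> (b, a) \<in> parcs G"
    and irr: "\<And>a b. (a, b) \<in> parcs G \<Longrightarrow> a \<noteq> b"
    using G(1) by (auto simp: pair_graph_iff sym_def)
  from G show ?case
  proof (cases rule: hom_star_decomposition)
    case (star x)
    show ?thesis
    proof (cases "3 \<le> card (pverts G)")
      case True
      then have "S (card (pverts G) - 1) = S 1 powr (real (card (pverts G)) / 2)
        \<and> hom G H = degree_power_sum H (card (pverts G) - 1)"
        using le[OF True] star(3) eq by auto
      then show ?thesis using True star(1,2) by blast
    next
      case False
      then have "card (pverts G) = 2" using card_ge_2_no_isolated[OF G] by simp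
      then obtain a b where ab: "pverts G = {a, b}" "a \<noteq> b" by (auto simp: card_2_iff)
      define y where "y = (if x = a then b else a)"
      have y: "pverts G = {x, y}" "y \<noteq> x" using ab star(1) by (auto simp: y_def)
      then have "(x, y) \<in> parcs G" using star(2) by blast
      moreover from this have "(y, x) \<in> parcs G" by (rule sym)
      ultimately have nbr: "\<exists>w. pverts G = {v, w} \<and> (v, w) \<in> parcs G" if "v \<in> pverts G" for v
        using y that by auto
      have "perfect_matching G"
        unfolding perfect_matching_def
      proof
        fix v assume "v \<in> pverts G"
        then obtain w where w: "pverts G = {v, w}" "(v, w) \<in> parcs G" using nbr by blast
        have "w' = w" if "(v, w') \<in> parcs G" for w'
          using w(1) EV[OF that] irr[OF that] by auto
        with w(2) show "\<exists>!w. (v, w) \<in> parcs G" by blast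
      qed
      then show ?thesis ..
    qed
  next
    case (split A)
    let ?R = "induced G (pverts G - A)" and ?n = "card (pverts G)"
    let ?a = "card A" and ?b = "card (pverts G - A)"
    have RV: "pverts ?R \<noteq> {}" using split(3) by (metis card.empty induced_simps(1) not_numeral_le_zero)
    have R: "hom ?R H \<le> S 1 powr (real ?b / 2)"
      using hom_le_edges[of ?R] less' split RV by (auto simp: less_imp_le)
    have prod: "S 1 powr (real ?n / 2) = S 1 powr (real ?a / 2) * S 1 powr (real ?b / 2)"
      by (simp add: split(4) powr_add[symmetric] add_divide_distrib)
    have pos: "0 < S 1 powr (real ?b / 2)" "0 < S 1 powr (real ?a / 2)" using S_pos[of 1] by simp_all
    have hle: "real (hom G H) \<le> real (hom (induced G A) H) * real (hom ?R H)"
      using split(8) by (metis of_nat_mono of_nat_mult)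
    have hA: "real (hom (induced G A) H) \<le> S (?a - 1)" using split(7) by simp
    \<comment> \<open>A star on \<open>A\<close> with at least three vertices would be strictly
      worse than the edge bound, since \<open>A\<close> is smaller than \<open>G\<close>.\<close>
    have "?a = 2"
    proof (rule ccontr)
      assume "?a \<noteq> 2"
      then have "S (?a - 1) < S 1 powr (real ?a / 2)" using less'[of ?a] split by simp
      then have "S (?a - 1) * S 1 powr (real ?b / 2) < S 1 powr (real ?n / 2)"
        unfolding prod using pos by simp
      moreover have "real (hom (induced G A) H) * real (hom ?R H) \<le> S (?a - 1) * S 1 powr (real ?b / 2)"
        using hA R by (intro mult_mono) auto
      ultimately show False using hle eq by simp
    qed
    then obtain x y where A: "A = {x, y}" "x \<noteq> y" by (auto simp: card_2_iff)
    have hA1: "real (hom (induced G A) H) \<le> S 1" using hA \<open>?a = 2\<close> by simp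
    have S1a: "S 1 powr (real ?a / 2) = S 1" using \<open>?a = 2\<close> S_pos[of 1] by simp
    have Req: "real (hom ?R H) = S 1 powr (real ?b / 2)"
    proof (rule ccontr)
      assume "real (hom ?R H) \<noteq> S 1 powr (real ?b / 2)"
      then have "S 1 * real (hom ?R H) < S 1 * S 1 powr (real ?b / 2)" using R S_pos[of 1] by simp
      moreover have "real (hom (induced G A) H) * real (hom ?R H) \<le> S 1 * real (hom ?R H)"
        using hA1 by (intro mult_right_mono) auto
      ultimately show False using hle eq prod S1a by simp
    qed
    have "real (hom (induced G A) H) * real (hom ?R H) \<le> S 1 * S 1 powr (real ?b / 2)"
      unfolding Req using hA1 by (intro mult_right_mono) auto
    then have "real (hom G H) = real (hom (induced G A) H) * real (hom ?R H)"
      using hle eq prod S1a by simp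
    then have prodeq: "hom G H = hom (induced G A) H * hom ?R H"
      by (metis of_nat_eq_iff of_nat_mult)
    have "perfect_matching ?R \<or> 3 \<le> card (pverts ?R)
      \<and> S (card (pverts ?R) - 1) = S 1 powr (real (card (pverts ?R)) / 2)
      \<and> hom ?R H = degree_power_sum H (card (pverts ?R) - 1)
      \<and> (\<exists>x\<in>pverts ?R. \<forall>w\<in>pverts ?R - {x}. (x, w) \<in> parcs ?R)"
    proof (rule less.hyps)
      show "card (pverts ?R) < card (pverts G)" using split by simp
      show "S (m - 1) < S 1 powr (real m / 2)" if "3 \<le> m" "m < card (pverts ?R)" for m
        using that less'[of m] split by simp
      show "S (card (pverts ?R) - 1) \<le> S 1 powr (real (card (pverts ?R)) / 2)" if "3 \<le> card (pverts ?R)"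
        using that less'[of "card (pverts ?R)"] split by simp
    qed (use split RV Req in simp_all)
    \<comment> \<open>The remainder is smaller than \<open>G\<close>, so the strict inequality rules
      out a tie and only the matching is left.\<close>
    moreover have "S (?b - 1) \<noteq> S 1 powr (real ?b / 2)" if "3 \<le> ?b"
      using less'[of ?b] that split by simp
    ultimately have pmR: "perfect_matching ?R" by auto
    have "0 < real (hom G H)" unfolding eq using S_pos[of 1] by simp
    then have "hom G H \<noteq> 0" by simp
    have nocross: "z \<in> A" if pz: "(p, z) \<in> parcs G" and "p \<in> A" for p z
    proof (rule ccontr)
      assume "z \<notin> A"
      have "\<exists>q. A = {p, q} \<and> p \<noteq> q" using A \<open>p \<in> A\<close> by auto
      then obtain q where "A = {p, q}" "p \<noteq> q" by blast
      from complete_if_hom_eq_product[OF G(1) this split(1) pmR prodeq \<open>hom G H \<noteq> 0\<close> pz \<open>z \<notin> A\<close>] nc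
      show False by blast
    qed
    have "perfect_matching G"
      unfolding perfect_matching_def
    proof
      fix v assume v: "v \<in> pverts G"
      show "\<exists>!w. (v, w) \<in> parcs G"
      proof (cases "v \<in> A")
        case True
        obtain w where w: "(v, w) \<in> parcs G" using G(2) v by (auto simp: no_isolated_def)
        have "w' = w" if "(v, w') \<in> parcs G" for w'
          using that w nocross True A irr by blast
        with w show ?thesis by blast
      next
        case False
        then obtain w where w: "(v, w) \<in> parcs ?R" "\<And>w'. (v, w') \<in> parcs ?R \<Longrightarrow> w' = w"
          using pmR v unfolding perfect_matching_def by (metis DiffI induced_simps(1))
        have "(v, w') \<in> parcs ?R" if "(v, w') \<in> parcs G" for w'
          using that False EV nocross[OF sym[OF that]] by auto
        then show ?thesis using w by auto
      qed
    qed
    then show ?thesis ..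
  qed
qed

text \<open>
  If an edge between two leaves lost no homomorphism, then the neighbours of a vertex of \<open>H\<close> of
  maximum degree would be pairwise adjacent, and counting the edges at them would give at least
  \<open>\<Delta>\<^sup>2\<close>.
\<close>

lemma star_if_hom_eq:
  assumes D: "degree_power_sum H 1 < (max_degree H)\<^sup>2"
    and G: "pair_graph G" and x: "x \<in> pverts G" "\<And>w. w \<in> pverts G - {x} \<Longrightarrow> (x, w) \<in> parcs G"
    and eq: "hom G H = degree_power_sum H (card (pverts G) - 1)"
  shows "G = star_graph x (pverts G)"
proof (rule ccontr)
  assume ne: "G \<noteq> star_graph x (pverts G)"
  let ?T = "star_graph x (pverts G)"
  have fin: "finite (pverts G)" and EV: "\<And>a b. (a, b) \<in> parcs G \<Longrightarrow> a \<in> pverts G \<and> b \<in> pverts G"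
    and sym: "\<And>a b. (a, b) \<in> parcs G \<Longrightarrow> (b, a) \<in> parcs G"
    and irr: "\<And>a b. (a, b) \<in> parcs G \<Longrightarrow> a \<noteq> b"
    using G by (auto simp: pair_graph_iff sym_def)
  have sub: "parcs ?T \<subseteq> parcs G" using x sym by auto
  have "parcs G \<noteq> parcs ?T"
    using ne pair_pre_digraph.equality[of G ?T] by (metis old.unit.exhaust star_graph_simps(1))
  then obtain p q where pq: "(p, q) \<in> parcs G" "(p, q) \<notin> parcs ?T" using sub by auto
  then have pq': "p \<in> pverts G" "q \<in> pverts G" "p \<noteq> q" "p \<noteq> x" "q \<noteq> x" using EV irr by auto
  have homs_eq: "homs G H = homs ?T H"
  proof (rule card_subset_eq)
    show "finite (homs ?T H)" using fin finite_pverts by (intro finite_homs) auto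
    show "homs G H \<subseteq> homs ?T H" using sub by (intro homs_antimono) auto
    show "card (homs G H) = card (homs ?T H)"
      using eq hom_star_graph[OF fin x(1) pseudo] by (simp add: hom_def)
  qed
  obtain v where v: "v \<in> pverts H" "degree H v = max_degree H" by (rule max_degree_attained)
  let ?N = "{w. (v, w) \<in> parcs H}"
  have adj: "(c, d) \<in> parcs H" if cd: "c \<in> ?N" "d \<in> ?N" for c d
  proof -
    \<comment> \<open>The centre goes to \<open>v\<close>, the leaf \<open>q\<close> to
      \<open>d\<close>, and every other leaf, in particular \<open>p\<close>, to
      \<open>c\<close>.\<close>
    let ?h = "\<lambda>w\<in>pverts G. if w = x then v else if w = q then d else c"
    have "?h \<in> homs ?T H"
      using x(1) v(1) cd arc_sym arc_in_pverts by (auto simp: homs_def)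
    then have "?h \<in> homs G H" using homs_eq by simp
    then have "(?h p, ?h q) \<in> parcs H" using pq(1) unfolding homs_def by blast
    then show ?thesis using pq' by simp
  qed
  \<comment> \<open>By \<open>adj\<close> the whole set \<open>?N\<close>, of size \<Delta>, lies in
    the neighbourhood of \<open>c\<close>.\<close>
  have "max_degree H \<le> degree H c" if "c \<in> ?N" for c
    unfolding v(2)[symmetric] degree_eq_card_neighbours
    using adj[OF that] finite_neighbours by (intro card_mono) auto
  then have "card ?N * max_degree H \<le> (\<Sum>c\<in>?N. degree H c)"
    using sum_bounded_below[of ?N "max_degree H" "degree H"] by simp
  also have "\<dots> \<le> degree_power_sum H 1"
    unfolding degree_power_sum_def using arc_in_pverts finite_pverts
    by (simp, intro sum_mono2) auto
  finally show False
    using D v(2) by (simp add: degree_eq_card_neighbours power2_eq_square)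
qed

section \<open>Sign and growth of the star excess\<close>

text \<open>The affine term cancels, leaving strict log-convexity of \<open>S\<close>. Two different
  degrees exist: if all were \<Delta>, then \<open>S 1\<close> would be \<Delta> times the number of
  vertices, hence at least the square of \<Delta>.\<close>

lemma star_excess_strictly_convex:
  assumes "degree_power_sum H 1 < (max_degree H)\<^sup>2"
  shows "2 * star_excess (Suc j) < star_excess j + star_excess (Suc (Suc j))"
proof -
  obtain v where v: "v \<in> pverts H" "degree H v = max_degree H" by (rule max_degree_attained)
  have "\<exists>w\<in>pverts H. degree H v \<noteq> degree H w"
  proof (rule ccontr)
    assume "\<not> ?thesis"
    then have "degree H w = max_degree H" if "w \<in> pverts H" for w
      using that v(2) by metis
    then have "degree_power_sum H 1 = card (pverts H) * max_degree H"
      by (simp add: degree_power_sum_def)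
    moreover have "max_degree H \<le> card (pverts H)" using degree_le_card v(2) by metis
    ultimately show False using assms by (simp add: power2_eq_square)
  qed
  then obtain w where "w \<in> pverts H" "degree H v \<noteq> degree H w" by blast
  moreover have idx: "Suc j + 1 = j + 2" "Suc (Suc j) + 1 = j + 3" "j + 1 + 1 = j + 2" "j + 1 + 2 = j + 3"
    by simp_all
  ultimately have "(S (j + 2))\<^sup>2 < S (j + 1) * S (j + 3)"
    using S_log_convex[OF v(1), of _ "j + 1"] by metis
  then have "ln ((S (j + 2))\<^sup>2) < ln (S (j + 1) * S (j + 3))"
    using S_pos[of "j + 2"] by (intro ln_strict_mono) (auto intro: zero_less_power)
  then have "2 * ln (S (j + 2)) < ln (S (j + 1)) + ln (S (j + 3))"
    using S_pos[of "j + 1"] S_pos[of "j + 2"] S_pos[of "j + 3"]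
    by (simp add: ln_mult_pos ln_realpow)
  then show ?thesis unfolding star_excess_def idx by (simp add: field_simps)
qed

text \<open>Taking the power \<open>2 / m\<close> puts the comparison into the form used by
  \<open>star_exceeds\<close>.\<close>

lemma S_powr:
  assumes "2 \<le> m"
  shows "S (m - 1) powr (2 / real m) = S 1 * exp (star_excess (m - 2) * (2 / real m))"
proof -
  have "S (m - 1) powr (2 / real m)
    = (S 1 powr (real m / 2)) powr (2 / real m) * exp (star_excess (m - 2)) powr (2 / real m)"
    unfolding S_eq_exp_star_excess[OF assms] by (rule powr_mult)
  also have "(S 1 powr (real m / 2)) powr (2 / real m) = S 1"
    using assms S_pos[of 1] by (simp add: powr_powr)
  finally show ?thesis by (simp add: exp_powr_real)
qed

lemma star_exceeds_iff: "star_exceeds H m \<longleftrightarrow> 3 \<le> m \<and> 0 < star_excess (m - 2)"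
proof (cases "3 \<le> m")
  case True
  then have "S 1 < S 1 * exp (star_excess (m - 2) * (2 / real m)) \<longleftrightarrow> 0 < star_excess (m - 2)"
    using S_pos[of 1] by (simp add: zero_less_divide_iff)
  with True show ?thesis
    unfolding star_exceeds_def hom_complete_graph_2[OF pseudo] hom_complete_bipartite_1[OF pseudo]
    by (subst S_powr) auto
qed (simp add: star_exceeds_def)

text \<open>A single vertex of degree \<Delta> gives \<open>S (m - 1)\<close> at least the power
  \<open>m - 1\<close> of \<Delta>. So the excess is at least \<open>m * c / 2 - ln ?D\<close> with
  \<open>c > 0\<close>, which is eventually positive; \<open>k\<close> is chosen to achieve
  this.\<close>

lemma star_exceeds_exists:
  assumes "degree_power_sum H 1 < (max_degree H)\<^sup>2"
  shows "\<exists>m. star_exceeds H m"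
proof -
  let ?D = "real (max_degree H)"
  define c where "c = 2 * ln ?D - ln (S 1)"
  have D0: "0 < ?D" using max_degree_pos by simp
  have "S 1 < ?D\<^sup>2" using assms by (metis of_nat_less_iff of_nat_power)
  then have "ln (S 1) < ln (?D\<^sup>2)" using S_pos[of 1] D0 by (subst ln_less_cancel_iff) auto
  then have c: "0 < c" using D0 by (simp add: c_def ln_realpow)
  obtain k :: nat where k: "2 * ln ?D / c < real k" using reals_Archimedean2 by blast
  define m where "m = k + 3"
  have "ln (?D ^ (m - 1)) \<le> ln (S (m - 1))"
    using power_max_degree_le[of "m - 1"] D0 S_pos[of "m - 1"]
    by (subst ln_le_cancel_iff) (simp_all flip: of_nat_power)
  moreover have "ln (?D ^ (m - 1)) = (real m - 1) * ln ?D"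
    using D0 by (subst ln_realpow) (simp_all add: m_def)
  ultimately have "(real m - 1) * ln ?D \<le> ln (S (m - 1))" by simp
  moreover have "2 * ln ?D < real m * c"
  proof -
    have "2 * ln ?D < real k * c" using k c by (simp add: divide_less_eq)
    also have "\<dots> \<le> real m * c" using c by (intro mult_right_mono) (auto simp: m_def)
    finally show ?thesis .
  qed
  moreover have "star_excess (m - 2) = ln (S (m - 1)) - real m / 2 * ln (S 1)"
    by (simp add: star_excess_def m_def numeral_3_eq_3)
  ultimately have "0 < star_excess (m - 2)" by (simp add: c_def algebra_simps)
  then show ?thesis unfolding star_exceeds_iff by (intro exI[of _ m]) (simp add: m_def)
qed

text \<open>At a size with positive excess, supermultiplicativity of the majorant is strict, so
  every proper split loses and equality leaves only a spanning star.\<close>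

lemma hom_le_spanning_star:
  assumes D: "degree_power_sum H 1 < (max_degree H)\<^sup>2"
    and G: "pair_graph G" "no_isolated G" "pverts G \<noteq> {}"
    and pos: "0 < star_excess (card (pverts G) - 2)"
  shows "hom G H \<le> degree_power_sum H (card (pverts G) - 1)"
    and "hom G H = degree_power_sum H (card (pverts G) - 1) \<Longrightarrow>
      \<exists>x\<in>pverts G. \<forall>w\<in>pverts G - {x}. (x, w) \<in> parcs G"
proof -
  note convex = star_excess_0 star_excess_strictly_convex[OF D]
  let ?n = "card (pverts G)"
  \<comment> \<open>For \<open>2 \<le> m\<close> this is the maximum of the edge value and the star
    value \<open>S (m - 1)\<close>.\<close>
  define M where "M m = S 1 powr (real m / 2) * exp (max 0 (star_excess (m - 2)))" for m
  have M0: "0 < M m" for m using S_pos[of 1] by (simp add: M_def)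
  have M1: "S (a - 1) \<le> M a" if "2 \<le> a" for a
    unfolding S_eq_exp_star_excess[OF that] M_def by (intro mult_left_mono) auto
  have Mmult: "M a * M b = S 1 powr (real (a + b) / 2) * exp (max 0 (star_excess (a - 2)) + max 0 (star_excess (b - 2)))" for a b
    by (simp add: M_def powr_add exp_add add_divide_distrib)
  have idx: "a + b - 2 = (a - 2) + (b - 2) + 2" if "2 \<le> a" "2 \<le> b" for a b :: nat
    using that by simp
  have M2: "M a * M b \<le> M (a + b)" if "2 \<le> a" "2 \<le> b" for a b
    unfolding Mmult using strictly_convex_positive_part(1)[OF convex, of "a - 2" "b - 2"]
    by (simp add: M_def idx[OF that] mult_left_mono)
  have M3: "M a * M b < M (a + b)" if "2 \<le> a" "2 \<le> b" "0 < star_excess (a + b - 2)" for a b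
    unfolding Mmult using strictly_convex_positive_part(2)[OF convex, of "a - 2" "b - 2"] that(3) S_pos[of 1]
    by (simp add: M_def idx[OF that(1,2)])
  have Mn: "M ?n = S (?n - 1)"
    using S_eq_exp_star_excess[OF card_ge_2_no_isolated[OF G]] pos by (simp add: M_def)
  have le: "hom G' H \<le> M (card (pverts G'))"
    if "pair_graph G'" "no_isolated G'" "pverts G' \<noteq> {}" for G' :: "'b pair_pre_digraph"
    using that by (intro hom_le_supermultiplicative[OF M1 M2]) auto
  have *: "hom G H < degree_power_sum H (?n - 1) \<or>
     hom G H \<le> degree_power_sum H (?n - 1) \<and> (\<exists>x\<in>pverts G. \<forall>w\<in>pverts G - {x}. (x, w) \<in> parcs G)"
    using G
  proof (cases rule: hom_star_decomposition)
    case (star x)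
    then show ?thesis by blast
  next
    case (split A)
    let ?R = "induced G (pverts G - A)"
    have "pverts ?R \<noteq> {}" using split(3) by (metis card.empty induced_simps(1) not_numeral_le_zero)
    then have "real (hom ?R H) \<le> M (card (pverts ?R))"
      using split(5,6) by (intro le)
    moreover have "real (hom (induced G A) H) \<le> M (card A)"
      using of_nat_mono[OF split(7), where 'a = real] M1[OF split(2)] by (rule order.trans)
    ultimately have "real (hom (induced G A) H) * real (hom ?R H) \<le> M (card A) * M (card (pverts ?R))"
      using M0[of "card A"] by (intro mult_mono) auto
    also have "\<dots> < M ?n"
      using M3[OF split(2,3)] pos split(4) by simp
    finally have "real (hom G H) < S (?n - 1)"
      using of_nat_mono[OF split(8), where 'a = real] Mn by simp
    then show ?thesis by simp
  qed
  then show "hom G H \<le> degree_power_sum H (?n - 1)" by auto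
  show "\<exists>x\<in>pverts G. \<forall>w\<in>pverts G - {x}. (x, w) \<in> parcs G"
    if "hom G H = degree_power_sum H (?n - 1)"
    using * that by auto
qed

lemma hom_perfect_matching_powr:
  assumes "pair_graph G" "perfect_matching G"
  shows "real (hom G H) = S 1 powr (real (card (pverts G)) / 2)"
proof -
  have even: "even (card (pverts G))"
    using hom_perfect_matching[OF assms pseudo] by simp
  have "real (hom G H) = S 1 ^ (card (pverts G) div 2)"
    using hom_perfect_matching[OF assms pseudo] by simp
  also have "S 1 ^ (card (pverts G) div 2) = S 1 powr real (card (pverts G) div 2)"
    using S_pos[of 1] by (simp add: powr_realpow)
  also have "real (card (pverts G) div 2) = real (card (pverts G)) / 2"
    using even by (simp add: real_of_nat_div)
  finally show ?thesis .
qed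

lemma perfect_matching_iff_iso:
  assumes "pair_graph G"
  shows "perfect_matching G \<longleftrightarrow> even (card (pverts G))
    \<and> G \<simeq>\<^sub>G disjoint_copies (card (pverts G) div 2) (complete_graph 2)"
proof
  assume pm: "perfect_matching G"
  then have "even (card (pverts G))" using hom_perfect_matching[OF assms _ pseudo] by blast
  with iso_disjoint_copies_if_perfect_matching[OF assms pm, of "card (pverts G) div 2"]
  show "even (card (pverts G)) \<and> G \<simeq>\<^sub>G disjoint_copies (card (pverts G) div 2) (complete_graph 2)"
    by simp
qed (use perfect_matching_if_iso_disjoint_copies[OF assms] in blast)

lemma hom_iso_star:
  assumes "pair_graph G" "G \<simeq>\<^sub>G complete_bipartite_graph 1 k"
  shows "hom G H = degree_power_sum H k"
proof -
  have "hom G H = hom (complete_bipartite_graph 1 k) H"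
    by (rule hom_cong_iso[OF _ assms(2)]) (use assms(1) in \<open>simp add: pair_graph_iff\<close>)
  then show ?thesis by (simp only: hom_complete_bipartite_1[OF pseudo])
qed

lemma iso_star_if_spanning_star:
  assumes D: "degree_power_sum H 1 < (max_degree H)\<^sup>2" and G: "pair_graph G" and "2 \<le> card (pverts G)"
    and "\<exists>x\<in>pverts G. \<forall>w\<in>pverts G - {x}. (x, w) \<in> parcs G"
    and "hom G H = degree_power_sum H (card (pverts G) - 1)"
  shows "G \<simeq>\<^sub>G complete_bipartite_graph 1 (card (pverts G) - 1)"
proof -
  obtain x where x: "x \<in> pverts G" "\<And>w. w \<in> pverts G - {x} \<Longrightarrow> (x, w) \<in> parcs G"
    using assms(4) by blast
  then have "G = star_graph x (pverts G)" using star_if_hom_eq[OF D G x assms(5)] by blast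
  with x(1) show ?thesis
    using iso_star_iff[OF G, of "card (pverts G) - 1"] assms(3) by auto
qed

section \<open>The bounds and their equality cases in the three ranges\<close>

text \<open>Here every star with at least two leaves is strictly worse than the edge bound, so the
  star alternative of \<open>hom_eq_edges_cases\<close> cannot occur.\<close>

lemma hom_bound_many_edges:
  assumes D: "(max_degree H)\<^sup>2 \<le> degree_power_sum H 1"
    and nc: "\<not> H \<simeq>\<^sub>G complete_looped_graph (max_degree H)"
    and G: "pair_graph G" "no_isolated G" "pverts G \<noteq> {}" and n: "card (pverts G) = n"
  shows "hom G H \<le> S 1 powr (real n / 2)
    \<and> (hom G H = S 1 powr (real n / 2) \<longleftrightarrow>
        even n \<and> G \<simeq>\<^sub>G disjoint_copies (n div 2) (complete_graph 2))"
proof -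
  have nc': "\<not> pverts H \<times> pverts H \<subseteq> parcs H"
    using nc iso_complete_looped_graph[OF pseudo nonempty] by blast
  note less = S_less_powr_if_max_degree_le[OF D nc']
  have "perfect_matching G" if "hom G H = S 1 powr (real (card (pverts G)) / 2)"
  proof -
    have "perfect_matching G \<or> 3 \<le> card (pverts G)
      \<and> S (card (pverts G) - 1) = S 1 powr (real (card (pverts G)) / 2)
      \<and> hom G H = degree_power_sum H (card (pverts G) - 1)
      \<and> (\<exists>x\<in>pverts G. \<forall>w\<in>pverts G - {x}. (x, w) \<in> parcs G)"
      by (rule hom_eq_edges_cases[OF less less_imp_le[OF less] nc' G that])
    with less[of "card (pverts G)"] show ?thesis by auto
  qed
  then show ?thesis
    using hom_le_edges[OF less_imp_le[OF less] G] hom_perfect_matching_powr[OF G(1)]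
      perfect_matching_iff_iso[OF G(1)] unfolding n by blast
qed

lemma hom_bound_below_n0:
  assumes D: "degree_power_sum H 1 < (max_degree H)\<^sup>2"
    and G: "pair_graph G" "no_isolated G" "pverts G \<noteq> {}" and n: "card (pverts G) = n"
    and "n < n0 H"
  shows "hom G H \<le> S 1 powr (real n / 2)
    \<and> (hom G H = S 1 powr (real n / 2) \<longleftrightarrow>
        even n \<and> G \<simeq>\<^sub>G disjoint_copies (n div 2) (complete_graph 2)
        \<or> n = n0 H - 1 \<and> S 1 = S (n0 H - 2) powr (2 / real (n0 H - 1))
          \<and> G \<simeq>\<^sub>G complete_bipartite_graph 1 (n - 1))"
proof -
  note inc = strictly_convex_increasing[OF star_excess_0 star_excess_strictly_convex[OF D]]
  have n2: "2 \<le> n" using card_ge_2_no_isolated[OF G] n by simp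
  have u_le: "star_excess (m - 2) \<le> 0" if "3 \<le> m" "m \<le> n" for m
    using not_less_Least[of m "star_exceeds H"] that \<open>n < n0 H\<close>
    unfolding n0_def star_exceeds_iff by (simp add: not_less)
  \<comment> \<open>A nonnegative excess before \<open>n\<close> would increase strictly and be
    positive at \<open>n\<close>, against minimality of \<open>n0 H\<close>.\<close>
  have u_less: "star_excess (m - 2) < 0" if "3 \<le> m" "m < n" for m
  proof (rule ccontr)
    assume "\<not> star_excess (m - 2) < 0"
    then have "star_excess (m - 2) < star_excess (n - 2)" using that by (intro inc) auto
    with \<open>\<not> star_excess (m - 2) < 0\<close> u_le[of n] that show False by simp
  qed
  have le: "S (m - 1) \<le> S 1 powr (real m / 2)" if "3 \<le> m" "m \<le> card (pverts G)" for m
    using S_eq_exp_star_excess[of m] u_le[of m] that n S_pos[of 1] by simp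
  have less: "S (m - 1) < S 1 powr (real m / 2)" if "3 \<le> m" "m < card (pverts G)" for m
    using S_eq_exp_star_excess[of m] u_less[of m] that n S_pos[of 1] by simp
  \<comment> \<open>A complete looped \<open>H\<close> would have \<open>S 1\<close> equal to the
    square of \<Delta>.\<close>
  have nc: "\<not> pverts H \<times> pverts H \<subseteq> parcs H"
  proof
    assume all: "pverts H \<times> pverts H \<subseteq> parcs H"
    have "degree H v = card (pverts H)" if "v \<in> pverts H" for v
    proof -
      have "{w. (v, w) \<in> parcs H} = pverts H" using all that arc_in_pverts by blast
      then show ?thesis by (simp add: degree_eq_card_neighbours)
    qed
    moreover obtain v where "v \<in> pverts H" "degree H v = max_degree H" by (rule max_degree_attained)
    ultimately show False using D by (simp add: degree_power_sum_def power2_eq_square)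
  qed
  have powr_iff: "S 1 = S (n - 1) powr (2 / real n) \<longleftrightarrow> S (n - 1) = S 1 powr (real n / 2)"
    using S_powr[OF n2] S_eq_exp_star_excess[OF n2] S_pos[of 1] n2 by simp
  \<comment> \<open>A tie at \<open>n\<close> means zero excess, so the excess is positive at
    \<open>n + 1\<close>; hence \<open>n0 H = n + 1\<close>.\<close>
  have star: "n = n0 H - 1 \<and> S 1 = S (n0 H - 2) powr (2 / real (n0 H - 1))"
    if "3 \<le> n" "S (n - 1) = S 1 powr (real n / 2)"
  proof -
    have "star_excess (n - 2) = 0" using that S_eq_exp_star_excess[OF n2] S_pos[of 1] by simp
    then have "0 < star_excess (n + 1 - 2)" using inc[of "n - 2" "n + 1 - 2"] that(1) by simp
    then have "star_exceeds H (n + 1)" unfolding star_exceeds_iff using that(1) by simp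
    then have "n0 H \<le> n + 1" unfolding n0_def by (rule Least_le)
    then have "n0 H - 1 = n" "n0 H - 2 = n - 1" using \<open>n < n0 H\<close> by auto
    with that(2) powr_iff show ?thesis by simp
  qed
  have eq_imp: "perfect_matching G \<or> n = n0 H - 1 \<and> S 1 = S (n0 H - 2) powr (2 / real (n0 H - 1))
        \<and> G \<simeq>\<^sub>G complete_bipartite_graph 1 (n - 1)"
    if "hom G H = S 1 powr (real (card (pverts G)) / 2)"
    using hom_eq_edges_cases[OF less le[OF _ order_refl] nc G that] star
      iso_star_if_spanning_star[OF D G(1)] n2 unfolding n by blast
  have "real (hom G H) = S 1 powr (real n / 2)"
    if "n = n0 H - 1" "S 1 = S (n0 H - 2) powr (2 / real (n0 H - 1))"
      "G \<simeq>\<^sub>G complete_bipartite_graph 1 (n - 1)"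
  proof -
    have "n0 H - 2 = n - 1" using that(1) by simp
    then have "S 1 = S (n - 1) powr (2 / real n)" using that(1,2) by simp
    then show ?thesis using powr_iff hom_iso_star[OF G(1) that(3)] by simp
  qed
  then show ?thesis
    using hom_le_edges[OF le G] eq_imp hom_perfect_matching_powr[OF G(1)]
      perfect_matching_iff_iso[OF G(1)] unfolding n by blast
qed

text \<open>The excess is positive at \<open>n0 H\<close> and increases from there, so the spanning
  star bound applies to every larger size.\<close>

lemma hom_bound_from_n0:
  assumes D: "degree_power_sum H 1 < (max_degree H)\<^sup>2"
    and G: "pair_graph G" "no_isolated G" "pverts G \<noteq> {}" and n: "card (pverts G) = n"
    and "n0 H \<le> n"
  shows "hom G H \<le> degree_power_sum H (n - 1)
    \<and> (hom G H = degree_power_sum H (n - 1) \<longleftrightarrow> G \<simeq>\<^sub>G complete_bipartite_graph 1 (n - 1))"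
proof -
  have "star_exceeds H (n0 H)"
    unfolding n0_def using star_exceeds_exists[OF D] by (rule LeastI_ex)
  then have n0: "3 \<le> n0 H" "0 < star_excess (n0 H - 2)" by (simp_all add: star_exceeds_iff)
  have "0 < star_excess (n - 2)"
  proof (cases "n0 H = n")
    case False
    then have "star_excess (n0 H - 2) < star_excess (n - 2)"
      using n0 \<open>n0 H \<le> n\<close> by (intro strictly_convex_increasing[OF star_excess_0 star_excess_strictly_convex[OF D]]) auto
    with n0 show ?thesis by simp
  qed (use n0 in simp)
  then have pos: "0 < star_excess (card (pverts G) - 2)" by (simp add: n)
  have "2 \<le> card (pverts G)" by (rule card_ge_2_no_isolated[OF G])
  then show ?thesis
    using hom_le_spanning_star[OF D G pos] iso_star_if_spanning_star[OF D G(1)]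
      hom_iso_star[OF G(1)] unfolding n by blast
qed

end

theorem theorem1p4:
  fixes H :: "'h pair_pre_digraph" and G :: "'g pair_pre_digraph" and n \<Delta> :: nat
  assumes "pair_pseudo_graph H" and "pverts H \<noteq> {}"
    and "\<not> (\<exists>v. isolated H v)"
    and "\<Delta> = max_degree H"
    and "n \<ge> 2" and "G \<in> graphs_min_degree n 1"
  shows
    "(\<not> H \<simeq>\<^sub>G complete_looped_graph \<Delta> \<and> hom (complete_graph 2) H \<ge> \<Delta>\<^sup>2 \<longrightarrow>
        real (hom G H) \<le> real (hom (complete_graph 2) H) powr (real n / 2)
      \<and> (real (hom G H) = real (hom (complete_graph 2) H) powr (real n / 2)
          \<longleftrightarrow> even n \<and> G \<simeq>\<^sub>G disjoint_copies (n div 2) (complete_graph 2)))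
   \<and> (hom (complete_graph 2) H < \<Delta>\<^sup>2 \<longrightarrow>
        (\<exists>m. star_exceeds H m)
      \<and> (n < n0 H \<longrightarrow>
            real (hom G H) \<le> real (hom (complete_graph 2) H) powr (real n / 2)
          \<and> (real (hom G H) = real (hom (complete_graph 2) H) powr (real n / 2)
              \<longleftrightarrow> even n \<and> G \<simeq>\<^sub>G disjoint_copies (n div 2) (complete_graph 2)
                \<or> n = n0 H - 1
                  \<and> real (hom (complete_graph 2) H)
                      = real (hom (complete_bipartite_graph 1 (n0 H - 2)) H)
                          powr (2 / real (n0 H - 1))
                  \<and> G \<simeq>\<^sub>G complete_bipartite_graph 1 (n - 1)))
      \<and> (n \<ge> n0 H \<longrightarrow>
            hom G H \<le> hom (complete_bipartite_graph 1 (n - 1)) H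
          \<and> (hom G H = hom (complete_bipartite_graph 1 (n - 1)) H
              \<longleftrightarrow> G \<simeq>\<^sub>G complete_bipartite_graph 1 (n - 1))))"
  (is "?many \<and> ?few")
proof -
  \<comment> \<open>Symmetry turns an arc entering \<open>v\<close> into one leaving it; a loop
    serves as well.\<close>
  have noH: "no_isolated H"
    unfolding no_isolated_def
  proof
    fix v assume "v \<in> pverts H"
    then obtain e where e: "e \<in> parcs H" "fst e = v \<or> snd e = v"
      using assms(3) by (auto simp: isolated_def)
    moreover have "(b, a) \<in> parcs H" if "(a, b) \<in> parcs H" for a b
      using assms(1) that by (auto simp: pair_pseudo_graph_iff sym_def)
    ultimately show "\<exists>w. (v, w) \<in> parcs H" by (cases e) auto
  qed
  interpret target_graph H using assms(1,2) noH by (rule target_graph.intro)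
  have G: "pair_graph G" "card (pverts G) = n" "min_degree G = 1"
    using assms(6) by (auto simp: graphs_min_degree_def)
  then have fin: "finite (pverts G)" and ne: "pverts G \<noteq> {}"
    using assms(5) by (auto simp: pair_graph_iff)
  have noG: "no_isolated G"
    unfolding no_isolated_def
  proof
    fix v assume "v \<in> pverts G"
    then have "1 \<le> degree G v"
      using G(3) fin unfolding min_degree_def by (metis Min_le finite_imageI imageI)
    then have "{w. (v, w) \<in> parcs G} \<noteq> {}"
      by (metis card.empty degree_eq_card_neighbours not_one_le_zero)
    then show "\<exists>w. (v, w) \<in> parcs G" by blast
  qed
  note bounds = hom_bound_many_edges[OF _ _ G(1) noG ne G(2)]
    hom_bound_below_n0[OF _ G(1) noG ne G(2)] hom_bound_from_n0[OF _ G(1) noG ne G(2)]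
  note homs = hom_complete_graph_2[OF pseudo] hom_complete_bipartite_1[OF pseudo] assms(4)
  have ?many unfolding homs using bounds(1) by blast
  moreover have ?few unfolding homs using bounds(2,3) star_exceeds_exists by blast
  ultimately show ?thesis ..
qed

end
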